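(* Let $H$ be a complex Hilbert space and let $L$ be a locally compact Hausdorff space whose topology is denoted by $\tau$. For each derivation $D$ on $C_0(L,K(H))$ there exists a bounded function $Z_0:L\to B(H)$ which is $\tau$-to-$s^*(B(H),B(H)_* )$ continuous (i.e. $Z_0\in M(C_0(L,K(H)))$), with $\|Z_0\|\leq2\|D\|$ and $D(X)=[Z_0,X]$ for every $X\in C_0(L,K(H))$.
   Context: $B(H)$ is the algebra of bounded operators on $H$ and $K(H)$ the C$^*$-algebra of compact operators. $s^*(B(H),B(H)_* )$ is the strong$^*$ topology of $B(H)$ in the sense of von Neumann algebra theory, i.e. the one generated by the seminorms $x\mapsto\varphi(x^*x)^{1/2}$ and $x\mapsto\varphi(xx^* )^{1/2}$, with $\varphi$ running over the positive normal functionals on $B(H)$. $C_0(L,K(H))$ is the C$^*$-algebra of all norm-continuous functions $L\to K(H)$ vanishing at infinity, with pointwise operations and the supremum norm. Its multiplier algebra $M(C_0(L,K(H)))$ is identified with the C$^*$-algebra $C_b(L,(B(H),s^* ))$ of bounded functions $L\to B(H)$ that are continuous for the strong$^*$ topology. $\|Z_0\|=\sup_{t\in L}\|Z_0(t)\|$ and $[Z_0,X](t)=Z_0(t)X(t)-X(t)Z_0(t)$. A derivation on a C$^*$-algebra $B$ is a linear map $D:B\to B$ with $D(ab)=D(a)b+aD(b)$ for all $a,b\in B$ (automatically bounded). *)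

theory Defs
  imports "HOL-Analysis.Analysis"
begin

class complex_hilbert_space = banach +
  fixes scaleC :: "complex \<Rightarrow> 'a \<Rightarrow> 'a" (infixr \<open>*\<^sub>C\<close> 75)
    and cinner :: "'a \<Rightarrow> 'a \<Rightarrow> complex"
  assumes scaleC_add_right: "c *\<^sub>C (x + y) = c *\<^sub>C x + c *\<^sub>C y"
    and scaleC_add_left: "(c + d) *\<^sub>C x = c *\<^sub>C x + d *\<^sub>C x"
    and scaleC_scaleC: "c *\<^sub>C d *\<^sub>C x = (c * d) *\<^sub>C x"
    and scaleC_one: "1 *\<^sub>C x = x"
    and scaleR_scaleC: "r *\<^sub>R x = complex_of_real r *\<^sub>C x"
    and cinner_commute: "cinner x y = cnj (cinner y x)"
    and cinner_add_left: "cinner (x + y) z = cinner x z + cinner y z"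
    and cinner_scaleC_left: "cinner (c *\<^sub>C x) y = c * cinner x y"
    and cinner_self_nonneg: "0 \<le> Re (cinner x x)"
    and cinner_eq_zero_iff: "cinner x x = 0 \<longleftrightarrow> x = 0"
    and norm_eq_sqrt_cinner: "norm x = sqrt (Re (cinner x x))"

instantiation complex :: complex_hilbert_space
begin

definition scaleC_complex :: "complex \<Rightarrow> complex \<Rightarrow> complex"
  where "scaleC_complex c x = c * x"

definition cinner_complex :: "complex \<Rightarrow> complex \<Rightarrow> complex"
  where "cinner_complex x y = x * cnj y"

instance
  by standard
    (auto simp: scaleC_complex_def cinner_complex_def scaleR_conv_of_real algebra_simps
      cmod_def power2_eq_square)

end

lemma norm_scaleC: "norm (c *\<^sub>C x) = cmod c * norm (x :: 'h::complex_hilbert_space)"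
proof -
  have "cinner (c *\<^sub>C x) (c *\<^sub>C x) = c * cnj (c * cinner x x)"
    by (metis cinner_scaleC_left cinner_commute)
  also have "\<dots> = complex_of_real ((cmod c)\<^sup>2) * cinner x x"
    by (metis cinner_commute complex_cnj_mult complex_norm_square mult.assoc)
  finally have "Re (cinner (c *\<^sub>C x) (c *\<^sub>C x)) = (cmod c)\<^sup>2 * Re (cinner x x)"
    by simp
  then show ?thesis
    by (simp add: norm_eq_sqrt_cinner[of x] norm_eq_sqrt_cinner[of "c *\<^sub>C x"] real_sqrt_mult)
qed

text \<open>
  The library type \<^typ>\<open>'h \<Rightarrow>\<^sub>L 'h\<close> consists of the bounded \<^emph>\<open>real\<close>-linear maps, with the operator
  norm. The C*-algebra of bounded operators is the closed real subalgebra of its complex-linear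
  elements.
\<close>

definition bounded_operators :: "('h::complex_hilbert_space \<Rightarrow>\<^sub>L 'h) set"
  where "bounded_operators =
    {T. \<forall>c x. blinfun_apply T (c *\<^sub>C x) = c *\<^sub>C blinfun_apply T x}"

lift_definition scaleC_op ::
    "complex \<Rightarrow> ('h::complex_hilbert_space \<Rightarrow>\<^sub>L 'h) \<Rightarrow> ('h \<Rightarrow>\<^sub>L 'h)"
  is "\<lambda>c T x. c *\<^sub>C T x"
proof -
  fix c :: complex and T :: "'h \<Rightarrow> 'h"
  assume "bounded_linear T"
  moreover have "bounded_linear (\<lambda>x :: 'h. c *\<^sub>C x)"
    by (rule bounded_linear_intro[where K = "cmod c"])
      (simp_all add: scaleC_add_right scaleR_scaleC scaleC_scaleC norm_scaleC mult.commute)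
  ultimately show "bounded_linear (\<lambda>x. c *\<^sub>C T x)"
    using bounded_linear_compose by blast
qed

definition hilbert_adjoint :: "('h::complex_hilbert_space \<Rightarrow>\<^sub>L 'h) \<Rightarrow> ('h \<Rightarrow>\<^sub>L 'h)"
  where "hilbert_adjoint T = (THE S. S \<in> bounded_operators \<and>
    (\<forall>x y. cinner (blinfun_apply T x) y = cinner x (blinfun_apply S y)))"

definition compact_operators :: "('h::complex_hilbert_space \<Rightarrow>\<^sub>L 'h) set"
  where "compact_operators =
    {T \<in> bounded_operators. compact (closure (blinfun_apply T ` cball 0 1))}"

definition positive_operator :: "('h::complex_hilbert_space \<Rightarrow>\<^sub>L 'h) \<Rightarrow> bool"
  where "positive_operator T \<longleftrightarrow>
    T \<in> bounded_operators \<and> (\<forall>x. cinner (blinfun_apply T x) x \<in> \<real>\<^sub>\<ge>\<^sub>0)"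

definition operator_le ::
    "('h::complex_hilbert_space \<Rightarrow>\<^sub>L 'h) \<Rightarrow> ('h \<Rightarrow>\<^sub>L 'h) \<Rightarrow> bool"
  where "operator_le S T \<longleftrightarrow> positive_operator (T - S)"

definition operator_lub ::
    "('h::complex_hilbert_space \<Rightarrow>\<^sub>L 'h) set \<Rightarrow> ('h \<Rightarrow>\<^sub>L 'h) \<Rightarrow> bool"
  where "operator_lub A s \<longleftrightarrow> s \<in> bounded_operators \<and> (\<forall>a\<in>A. operator_le a s) \<and>
    (\<forall>b\<in>bounded_operators. (\<forall>a\<in>A. operator_le a b) \<longrightarrow> operator_le s b)"

text \<open>
  Functionals are represented by functions on all real-linear maps, of which only the restriction
  to \<^const>\<open>bounded_operators\<close> matters.
\<close>

definition positive_functional :: "(('h::complex_hilbert_space \<Rightarrow>\<^sub>L 'h) \<Rightarrow> complex) \<Rightarrow> bool"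
  where "positive_functional \<phi> \<longleftrightarrow>
    (\<forall>S\<in>bounded_operators. \<forall>T\<in>bounded_operators. \<phi> (S + T) = \<phi> S + \<phi> T) \<and>
    (\<forall>c. \<forall>T\<in>bounded_operators. \<phi> (scaleC_op c T) = c * \<phi> T) \<and>
    (\<forall>T\<in>bounded_operators. \<phi> (hilbert_adjoint T o\<^sub>L T) \<in> \<real>\<^sub>\<ge>\<^sub>0)"

text \<open>
  A positive functional is normal if it preserves suprema of bounded upward directed families of
  positive operators. Norm boundedness of the family is implied by the existence of its least
  upper bound; the values of the functional on positive operators are real.
\<close>

definition positive_normal_functional ::
    "(('h::complex_hilbert_space \<Rightarrow>\<^sub>L 'h) \<Rightarrow> complex) \<Rightarrow> bool"
  where "positive_normal_functional \<phi> \<longleftrightarrow> positive_functional \<phi> \<and>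
    (\<forall>A s. A \<noteq> {} \<and> (\<forall>a\<in>A. positive_operator a) \<and>
       (\<forall>a\<in>A. \<forall>b\<in>A. \<exists>c\<in>A. operator_le a c \<and> operator_le b c) \<and>
       operator_lub A s \<longrightarrow> Re (\<phi> s) = (SUP a\<in>A. Re (\<phi> a)))"

definition strong_star_seminorms :: "(('h::complex_hilbert_space \<Rightarrow>\<^sub>L 'h) \<Rightarrow> real) set"
  where "strong_star_seminorms =
    {\<lambda>T. sqrt (Re (\<phi> (hilbert_adjoint T o\<^sub>L T))) | \<phi>. positive_normal_functional \<phi>} \<union>
    {\<lambda>T. sqrt (Re (\<phi> (T o\<^sub>L hilbert_adjoint T))) | \<phi>. positive_normal_functional \<phi>}"

definition strong_star_topology :: "('h::complex_hilbert_space \<Rightarrow>\<^sub>L 'h) topology"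
  where "strong_star_topology = topology_generated_by
    {{T \<in> bounded_operators. p (T - S) < \<epsilon>} | p S \<epsilon>.
      p \<in> strong_star_seminorms \<and> S \<in> bounded_operators \<and> 0 < \<epsilon>}"

lemma topspace_strong_star_topology:
  "topspace (strong_star_topology :: ('h::complex_hilbert_space \<Rightarrow>\<^sub>L 'h) topology)
    = bounded_operators"
proof -
  have "positive_normal_functional (\<lambda>T :: 'h \<Rightarrow>\<^sub>L 'h. 0)"
    by (auto simp: positive_normal_functional_def positive_functional_def)
  then have "(\<lambda>T :: 'h \<Rightarrow>\<^sub>L 'h. 0) \<in> strong_star_seminorms"
    unfolding strong_star_seminorms_def by force
  moreover have "(0 :: 'h \<Rightarrow>\<^sub>L 'h) \<in> bounded_operators"
  proof -
    have "c *\<^sub>C (0::'h) = 0" for c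
      by (metis add_cancel_right_right scaleC_add_right)
    then show ?thesis by (simp add: bounded_operators_def)
  qed
  ultimately have "bounded_operators \<in> {{T \<in> bounded_operators. p (T - S) < \<epsilon>} | p S \<epsilon>.
      p \<in> strong_star_seminorms \<and> (S :: 'h \<Rightarrow>\<^sub>L 'h) \<in> bounded_operators \<and> (0::real) < \<epsilon>}"
    by (intro CollectI exI[of _ "\<lambda>T. 0"] exI[of _ 0] exI[of _ 1]) auto
  then show ?thesis
    unfolding strong_star_topology_def topology_generated_by_topspace by blast
qed

text \<open>
  The space L is \<^term>\<open>topspace \<tau>\<close>. A function on L in the algebra below is represented by its
  extension by zero, so that equality of representatives is equality of functions on L.
\<close>

definition C0_compact_operators ::
    "'l topology \<Rightarrow> ('l \<Rightarrow> ('h::complex_hilbert_space \<Rightarrow>\<^sub>L 'h)) set"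
  where "C0_compact_operators \<tau> =
    {X. continuous_map \<tau> euclidean X \<and> (\<forall>t\<in>topspace \<tau>. X t \<in> compact_operators) \<and>
      (\<forall>\<epsilon>>0. \<exists>K. compactin \<tau> K \<and> (\<forall>t\<in>topspace \<tau> - K. norm (X t) < \<epsilon>)) \<and>
      (\<forall>t. t \<notin> topspace \<tau> \<longrightarrow> X t = 0)}"

text \<open>
  The inserted 0 only matters when L is empty, where \<^const>\<open>Sup\<close> on the reals is unspecified.
\<close>

definition sup_norm :: "'l topology \<Rightarrow> ('l \<Rightarrow> 'b::real_normed_vector) \<Rightarrow> real"
  where "sup_norm \<tau> F = Sup (insert 0 ((\<lambda>t. norm (F t)) ` topspace \<tau>))"

definition derivation_C0 ::
    "'l topology \<Rightarrow>
      (('l \<Rightarrow> ('h::complex_hilbert_space \<Rightarrow>\<^sub>L 'h)) \<Rightarrow> ('l \<Rightarrow> ('h \<Rightarrow>\<^sub>L 'h))) \<Rightarrow> bool"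
  where "derivation_C0 \<tau> D \<longleftrightarrow>
    (\<forall>X\<in>C0_compact_operators \<tau>. D X \<in> C0_compact_operators \<tau>) \<and>
    (\<forall>X\<in>C0_compact_operators \<tau>. \<forall>Y\<in>C0_compact_operators \<tau>.
       D (\<lambda>t. X t + Y t) = (\<lambda>t. D X t + D Y t)) \<and>
    (\<forall>c. \<forall>X\<in>C0_compact_operators \<tau>.
       D (\<lambda>t. scaleC_op c (X t)) = (\<lambda>t. scaleC_op c (D X t))) \<and>
    (\<forall>X\<in>C0_compact_operators \<tau>. \<forall>Y\<in>C0_compact_operators \<tau>.
       D (\<lambda>t. X t o\<^sub>L Y t) = (\<lambda>t. (D X t o\<^sub>L Y t) + (X t o\<^sub>L D Y t)))"

definition derivation_norm ::
    "'l topology \<Rightarrow>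
      (('l \<Rightarrow> ('h::complex_hilbert_space \<Rightarrow>\<^sub>L 'h)) \<Rightarrow> ('l \<Rightarrow> ('h \<Rightarrow>\<^sub>L 'h))) \<Rightarrow> real"
  where "derivation_norm \<tau> D =
    (SUP X\<in>{X \<in> C0_compact_operators \<tau>. sup_norm \<tau> X \<le> 1}. sup_norm \<tau> (D X))"

definition pointwise_commutator ::
    "('l \<Rightarrow> ('h::complex_hilbert_space \<Rightarrow>\<^sub>L 'h)) \<Rightarrow> ('l \<Rightarrow> ('h \<Rightarrow>\<^sub>L 'h)) \<Rightarrow> ('l \<Rightarrow> ('h \<Rightarrow>\<^sub>L 'h))"
  where "pointwise_commutator Z X = (\<lambda>t. (Z t o\<^sub>L X t) - (X t o\<^sub>L Z t))"

end

(*  The values of D at a point t depend only on the value of the argument at t, so D induces a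
    derivation of the compact operators at every t.  Writing x (x) e for the operator
    z |-> <z, e> x and fixing a unit vector e, that derivation is the commutator with
    Z(t) x = D(x (x) e)(t) e: apply the Leibniz rule to X (x (x) e) and evaluate at e.  Each functional
    x |-> <Z(t) x, y> is bounded, as the commutator with e (x) y shows, and uniform boundedness on
    C_0(L, H) bounds all Z(t) at once.  The same formulas make Z(t) x and Z(t)^* x norm continuous
    in t.  A normal functional nearly attains its norm on a finite rank projection, so on bounded
    sets this pointwise convergence implies strong* convergence.  *)

theory Submission
  imports Defs
begin

section \<open>Hilbert spaces\<close>

text \<open>Boundedness of \<open>D\<close> is not assumed, and until it is known
  \<open>derivation_norm\<close> is the supremum of a set that might be unbounded. So the uniform
  bound on the implementing operators has to precede every estimate by
  \<open>derivation_norm\<close>, and it is what gives that supremum a meaning. An operator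
  implementing the derivation of a single fibre is determined only up to a scalar multiple of the
  identity, so choices made separately at each t need not vary continuously; using the same e at
  every t fixes these scalars coherently. A constant function with value x (x) e need not vanish at
  infinity, hence the cut-offs. They equal 1 on a whole neighbourhood of t, so that one element of
  the algebra computes Z(s) x for all s near t. The cut-off of x (x) e has norm at most 1 for x in
  the unit ball, so the construction even yields norm at most ||D||, well within the factor
  2.\<close>

lemma cinner_add_right: "cinner x (y + z) = cinner x y + cinner x (z :: 'h::complex_hilbert_space)"
  by (metis cinner_add_left cinner_commute complex_cnj_add)

lemma cinner_scaleC_right: "cinner x (c *\<^sub>C y) = cnj c * cinner x (y :: 'h::complex_hilbert_space)"
  by (metis cinner_commute cinner_scaleC_left complex_cnj_mult)

lemma cinner_scaleR_left: "cinner (r *\<^sub>R x) y = r *\<^sub>R cinner x (y :: 'h::complex_hilbert_space)"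
  by (simp only: scaleR_scaleC[of r x] cinner_scaleC_left scaleR_conv_of_real)

lemma cinner_scaleR_right: "cinner x (r *\<^sub>R y) = r *\<^sub>R cinner x (y :: 'h::complex_hilbert_space)"
  by (simp only: scaleR_scaleC[of r y] cinner_scaleC_right scaleR_conv_of_real complex_cnj_complex_of_real)

lemma cinner_self: "cinner x x = complex_of_real ((norm (x :: 'h::complex_hilbert_space))\<^sup>2)"
proof -
  have "Im (cinner x x) = 0"
    by (metis cinner_commute cnj.simps(2) neg_equal_zero)
  moreover have "Re (cinner x x) = (norm x)\<^sup>2"
    by (simp add: norm_eq_sqrt_cinner cinner_self_nonneg)
  ultimately show ?thesis by (simp add: complex_eq_iff)
qed

lemma norm_add_squared:
  "(norm (x + y))\<^sup>2 = (norm x)\<^sup>2 + (norm (y :: 'h::complex_hilbert_space))\<^sup>2 + 2 * Re (cinner x y)"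
proof -
  have "complex_of_real ((norm (x + y))\<^sup>2) = cinner x x + cinner y y + (cinner x y + cnj (cinner x y))"
    unfolding cinner_self[symmetric]
    by (simp add: cinner_add_left cinner_add_right cinner_commute[of y x])
  then have "Re (complex_of_real ((norm (x + y))\<^sup>2)) = (norm x)\<^sup>2 + (norm y)\<^sup>2 + 2 * Re (cinner x y)"
    by (simp add: cinner_self complex_add_cnj)
  then show ?thesis by simp
qed

text \<open>The type class already supplies a norm with its triangle inequality, so the usual order
  is reversed: squaring the triangle inequality and comparing with the expansion of the squared norm
  gives Cauchy-Schwarz.\<close>

lemma Re_cinner_le: "Re (cinner x y) \<le> norm x * norm (y :: 'h::complex_hilbert_space)"
  using norm_add_squared[of x y] power_mono[OF norm_triangle_ineq[of x y], of 2]
  by (simp add: power2_sum)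

text \<open>Multiplying x by a complex number of modulus 1 turns the inner product into its modulus,
  which reduces the claim to real parts.\<close>

lemma norm_cinner_le: "norm (cinner x y) \<le> norm x * norm (y :: 'h::complex_hilbert_space)"
proof (cases "cinner x y = 0")
  case False
  define c where "c = cnj (cinner x y) / of_real (norm (cinner x y))"
  have "norm c = 1" using False by (simp add: c_def norm_divide)
  have "cnj (cinner x y) * cinner x y = of_real (norm (cinner x y)) * of_real (norm (cinner x y))"
    by (metis complex_norm_square mult.commute power2_eq_square of_real_power)
  then have "cinner (c *\<^sub>C x) y = of_real (norm (cinner x y))"
    using False by (simp add: cinner_scaleC_left c_def)
  then have "norm (cinner x y) = Re (cinner (c *\<^sub>C x) y)" by simp
  also have "\<dots> \<le> norm (c *\<^sub>C x) * norm y" by (rule Re_cinner_le)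
  finally show ?thesis using \<open>norm c = 1\<close> by (simp add: norm_scaleC)
qed simp

lemma bounded_bilinear_cinner:
  "bounded_bilinear (cinner :: 'h::complex_hilbert_space \<Rightarrow> 'h \<Rightarrow> complex)"
  by (rule bounded_bilinear.intro, auto simp: cinner_add_left cinner_add_right cinner_scaleR_left
      cinner_scaleR_right intro!: exI[of _ 1] norm_cinner_le)

interpretation cinner: bounded_bilinear "cinner :: 'h::complex_hilbert_space \<Rightarrow> 'h \<Rightarrow> complex"
  by (rule bounded_bilinear_cinner)

lemma bounded_bilinear_scaleC:
  "bounded_bilinear (scaleC :: complex \<Rightarrow> 'h::complex_hilbert_space \<Rightarrow> 'h)"
proof
  show "(r *\<^sub>R a) *\<^sub>C b = r *\<^sub>R a *\<^sub>C (b :: 'h)" for r a b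
    by (simp only: scaleR_scaleC[of r "a *\<^sub>C b"] scaleR_conv_of_real scaleC_scaleC)
  show "a *\<^sub>C (r *\<^sub>R b) = r *\<^sub>R a *\<^sub>C (b :: 'h)" for r a b
    by (simp only: scaleR_scaleC[where 'a='h] scaleC_scaleC mult.commute)
qed (auto simp: scaleC_add_left scaleC_add_right norm_scaleC intro!: exI[of _ 1])

interpretation scaleC: bounded_bilinear "scaleC :: complex \<Rightarrow> 'h::complex_hilbert_space \<Rightarrow> 'h"
  by (rule bounded_bilinear_scaleC)

lemma cinner_ext:
  assumes "\<And>z. cinner z x = cinner z (y :: 'h::complex_hilbert_space)"
  shows "x = y"
proof -
  have "cinner (x - y) (x - y) = 0"
    using assms[of "x - y"] by (simp add: cinner.diff_right)
  then show ?thesis by (simp add: cinner_eq_zero_iff)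
qed

section \<open>Riesz representation\<close>

lemma parallelogram:
  "(norm (x + y))\<^sup>2 + (norm (x - y))\<^sup>2 = 2 * (norm x)\<^sup>2 + 2 * (norm (y :: 'h::complex_hilbert_space))\<^sup>2"
  using norm_add_squared[of x y] norm_add_squared[of x "- y"] by (simp add: cinner.minus_right)

text \<open>The representing vector is the minimiser of \<open>\<parallel>x\<parallel>\<^sup>2 - 2 Re (f x)\<close>.\<close>

lemma riesz_representation:
  fixes f :: "'h::complex_hilbert_space \<Rightarrow> complex"
  assumes "bounded_linear f" and scaleC: "\<And>c x. f (c *\<^sub>C x) = c * f x"
  shows "\<exists>z. \<forall>x. f x = cinner x z"
proof -
  interpret f: bounded_linear f by fact
  define J where "J x = (norm x)\<^sup>2 - 2 * Re (f x)" for x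
  obtain K where K: "\<And>x. norm (f x) \<le> norm x * K" using f.bounded by blast
  \<comment> \<open>Completing the square: \<open>(norm x - K)\<close> squared is
    nonnegative.\<close>
  have lower: "- K\<^sup>2 \<le> J x" for x
  proof -
    have "Re (f x) \<le> norm x * K" using K[of x] complex_Re_le_cmod[of "f x"] by linarith
    moreover have "0 \<le> (norm x - K)\<^sup>2" by simp
    ultimately show ?thesis by (simp add: J_def power2_diff)
  qed
  define m where "m = Inf (range J)"
  have bdd: "bdd_below (range J)" using lower by (intro bdd_belowI[of _ "- K\<^sup>2"]) auto
  have m_le: "m \<le> J x" for x unfolding m_def using bdd by (auto intro: cInf_lower)
  define r where "r n = inverse (real (Suc n))" for n
  have "\<exists>x. J x < m + r n" for n
  proof -
    have "Inf (range J) < m + r n" by (simp add: m_def r_def)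
    then show ?thesis using bdd by (subst (asm) cInf_less_iff) auto
  qed
  then obtain X where X: "\<And>n. J (X n) < m + r n" by metis
  \<comment> \<open>The value of \<open>J\<close> at the midpoint is at least \<open>m\<close>; with
    the parallelogram law this forces any two near-minimisers to be close, so minimising sequences
    are Cauchy.\<close>
  have mid: "(norm (x - y))\<^sup>2 \<le> 2 * (J x - m) + 2 * (J y - m)" for x y
  proof -
    have "4 * m \<le> 4 * J ((1/2) *\<^sub>R (x + y))" using m_le by simp
    also have "\<dots> = (norm (x + y))\<^sup>2 - 4 * Re (f x) - 4 * Re (f y)"
      by (simp add: J_def f.scaleR f.add power_mult_distrib power_divide del: scaleR_add_right, simp add: field_simps)
    finally show ?thesis using parallelogram[of x y] by (simp add: J_def)
  qed
  have "Cauchy X"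
  proof (rule CauchyI)
    fix e :: real assume "0 < e"
    then obtain N where N: "r N < e\<^sup>2 / 4"
      using reals_Archimedean[of "e\<^sup>2 / 4"] by (auto simp: r_def)
    show "\<exists>M. \<forall>m\<ge>M. \<forall>n\<ge>M. norm (X m - X n) < e"
    proof (intro exI allI impI)
      fix i j assume "N \<le> i" "N \<le> j"
      then have "r i \<le> r N"
        "r j \<le> r N" by (auto simp: r_def intro!: le_imp_inverse_le)
      then have "(norm (X i - X j))\<^sup>2 < e\<^sup>2"
        using mid[of "X i" "X j"] X[of i] X[of j] N by simp
      then show "norm (X i - X j) < e" using \<open>0 < e\<close> by (simp add: power2_less_imp_less)
    qed
  qed
  then obtain z where z: "X \<longlonglongrightarrow> z" using Cauchy_convergent_iff convergent_def by blast
  have "(\<lambda>n. J (X n)) \<longlonglongrightarrow> J z"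
    unfolding J_def by (intro tendsto_intros z f.tendsto)
  moreover have "(\<lambda>n. m + r n) \<longlonglongrightarrow> m + 0"
    unfolding r_def by (intro tendsto_intros LIMSEQ_inverse_real_of_nat)
  ultimately have "J z \<le> m + 0"
    by (rule LIMSEQ_le) (use X less_imp_le in blast)
  then have Jz: "J z \<le> J y" for y using m_le[of y] by simp
  have Re_eq: "Re (f x) = Re (cinner x z)" for x
  proof -
    define b where "b = Re (cinner z x) - Re (f x)"
    \<comment> \<open>Moving from the minimiser \<open>z\<close> along the real line through
      \<open>x\<close> does not decrease \<open>J\<close>. The vertex of this parabola in
      \<open>s\<close> is \<open>- b / (norm x)^2\<close>, and nonnegativity there leaves only
      \<open>b = 0\<close>.\<close>
    have ineq: "0 \<le> s\<^sup>2 * (norm x)\<^sup>2 + 2 * s * b" for s :: real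
      using Jz[of "z + s *\<^sub>R x"] norm_add_squared[of z "s *\<^sub>R x"]
      by (simp add: J_def f.add f.scaleR cinner_scaleR_right power_mult_distrib b_def algebra_simps)
    have "b = 0"
    proof (cases "x = 0")
      case False
      then have p: "0 < (norm x)\<^sup>2" by simp
      have "(- b / w)\<^sup>2 * w + 2 * (- b / w) * b = - (b\<^sup>2 / w)" if "0 < w" for w
        using that by (simp add: field_simps power2_eq_square)
      from this[OF p] have "b\<^sup>2 / (norm x)\<^sup>2 \<le> 0" using ineq[of "- b / (norm x)\<^sup>2"] by linarith
      then show ?thesis using p by (simp add: divide_le_0_iff)
    qed (simp add: b_def cinner.zero_right f.zero)
    then show ?thesis using cinner_commute[of z x] by (simp add: b_def)
  qed
  have "f x = cinner x z" for x
  proof -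
    \<comment> \<open>Complex linearity recovers imaginary parts from the real parts at
      \<open>\<i> *\<^sub>C x\<close>.\<close>
    have "Im (f x) = Im (cinner x z)"
      using Re_eq[of "\<i> *\<^sub>C x"] by (simp add: scaleC cinner_scaleC_left)
    with Re_eq[of x] show ?thesis by (simp add: complex_eq_iff)
  qed
  then show ?thesis by blast
qed

section \<open>Bounded operators and adjoints\<close>

lemma bounded_operatorsI:
  "(\<And>c x. blinfun_apply T (c *\<^sub>C x) = c *\<^sub>C blinfun_apply T x) \<Longrightarrow> T \<in> bounded_operators"
  by (simp add: bounded_operators_def)

lemma bounded_operatorsD:
  "T \<in> bounded_operators \<Longrightarrow> blinfun_apply T (c *\<^sub>C x) = c *\<^sub>C blinfun_apply T x"
  by (simp add: bounded_operators_def)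

lemma bounded_operators_0: "0 \<in> bounded_operators"
  by (simp add: bounded_operators_def scaleC.zero_right)

lemma bounded_operators_id: "id_blinfun \<in> bounded_operators"
  by (simp add: bounded_operators_def)

lemma bounded_operators_add:
  "S \<in> bounded_operators \<Longrightarrow> T \<in> bounded_operators \<Longrightarrow> S + T \<in> bounded_operators"
  by (simp add: bounded_operators_def blinfun.add_left scaleC_add_right)

lemma bounded_operators_diff:
  "S \<in> bounded_operators \<Longrightarrow> T \<in> bounded_operators \<Longrightarrow> S - T \<in> bounded_operators"
  by (simp add: bounded_operators_def blinfun.diff_left scaleC.diff_right)

lemma bounded_operators_scaleC_op:
  "T \<in> bounded_operators \<Longrightarrow> scaleC_op c T \<in> bounded_operators"
  by (simp add: bounded_operators_def scaleC_op.rep_eq scaleC_scaleC mult.commute)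

lemma bounded_operators_compose:
  "S \<in> bounded_operators \<Longrightarrow> T \<in> bounded_operators \<Longrightarrow> S o\<^sub>L T \<in> bounded_operators"
  by (simp add: bounded_operators_def)

text \<open>Riesz, applied to \<open>x \<mapsto> cinner (T x) y\<close> for each y, gives the
  adjoint as a bare function; its linearity follows because a vector is determined by its inner
  products, and its norm bound by testing at \<open>x = S y\<close>.\<close>

lemma adjoint_exists:
  fixes T :: "'h::complex_hilbert_space \<Rightarrow>\<^sub>L 'h"
  assumes T: "T \<in> bounded_operators"
  shows "\<exists>S\<in>bounded_operators. \<forall>x y. cinner (T x) y = cinner x (S y)"
proof -
  have "\<exists>z. \<forall>x. cinner (T x) y = cinner x z" for y
    by (rule riesz_representation)
      (use T in \<open>auto simp: bounded_operatorsD cinner_scaleC_left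
        intro!: bounded_linear_compose[OF cinner.bounded_linear_left] blinfun.bounded_linear_right\<close>)
  then obtain S where S: "\<And>x y. cinner (T x) y = cinner x (S y)" by metis
  have S_scaleC: "S (c *\<^sub>C y) = c *\<^sub>C S y" for c y
    by (rule cinner_ext) (metis S cinner_scaleC_right)
  have "bounded_linear S"
  proof (rule bounded_linear_intro)
    show "S (x + y) = S x + S y" for x y
      by (rule cinner_ext) (metis S cinner_add_right)
    show "S (r *\<^sub>R y) = r *\<^sub>R S y" for r y
      by (simp only: scaleR_scaleC[where 'a='h] S_scaleC)
    show "norm (S y) \<le> norm y * norm T" for y
    proof (cases "S y = 0")
      case False
      have "(norm (S y))\<^sup>2 = Re (cinner (T (S y)) y)" by (simp add: S cinner_self)
      also have "\<dots> \<le> norm (T (S y)) * norm y" by (rule Re_cinner_le)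
      also have "\<dots> \<le> norm T * norm (S y) * norm y"
        by (intro mult_right_mono norm_blinfun) auto
      finally show ?thesis using False by (simp add: power2_eq_square mult.commute mult.left_commute)
    qed simp
  qed
  then show ?thesis
    by (intro bexI[of _ "Blinfun S"] bounded_operatorsI)
      (simp_all add: bounded_linear_Blinfun_apply S S_scaleC)
qed

text \<open>The adjoint is defined by a definite description; this is the uniqueness half, and
  thereby the way to compute any particular adjoint.\<close>

lemma hilbert_adjoint_eqI:
  assumes "S \<in> bounded_operators" and "\<And>x y. cinner (blinfun_apply T x) y = cinner x (S y)"
  shows "hilbert_adjoint T = S"
  unfolding hilbert_adjoint_def
proof (rule the_equality)
  fix R assume "R \<in> bounded_operators \<and> (\<forall>x y. cinner (T x) y = cinner x (R y))"
  then have "\<forall>x y. cinner x (R y) = cinner x (S y)" using assms by metis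
  then show "R = S" by (metis blinfun_eqI cinner_ext)
qed (use assms in auto)

lemma
  assumes "T \<in> bounded_operators"
  shows hilbert_adjoint_bounded_operators: "hilbert_adjoint T \<in> bounded_operators"
    and cinner_hilbert_adjoint: "cinner (blinfun_apply T x) y = cinner x (hilbert_adjoint T y)"
  using adjoint_exists[OF assms] hilbert_adjoint_eqI[of _ T] by auto

lemma cinner_hilbert_adjoint_left:
  assumes "T \<in> bounded_operators"
  shows "cinner (hilbert_adjoint T x) y = cinner x (blinfun_apply T y)"
  by (metis assms cinner_commute cinner_hilbert_adjoint)

lemma hilbert_adjoint_hilbert_adjoint:
  "T \<in> bounded_operators \<Longrightarrow> hilbert_adjoint (hilbert_adjoint T) = T"
  by (rule hilbert_adjoint_eqI) (simp_all add: cinner_hilbert_adjoint_left)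

lemma hilbert_adjoint_diff:
  assumes "S \<in> bounded_operators" "T \<in> bounded_operators"
  shows "hilbert_adjoint (S - T) = hilbert_adjoint S - hilbert_adjoint T"
  by (rule hilbert_adjoint_eqI)
    (simp_all add: assms bounded_operators_diff hilbert_adjoint_bounded_operators blinfun.diff_left
      cinner.diff_left cinner.diff_right cinner_hilbert_adjoint)

lemma norm_hilbert_adjoint_le:
  assumes T: "T \<in> bounded_operators"
  shows "norm (hilbert_adjoint T) \<le> norm T"
proof (rule norm_blinfun_bound)
  show "norm (hilbert_adjoint T y) \<le> norm T * norm y" for y
  proof (cases "hilbert_adjoint T y = 0")
    case False
    let ?z = "hilbert_adjoint T y"
    have "(norm ?z)\<^sup>2 = Re (cinner (T ?z) y)" by (simp add: cinner_hilbert_adjoint[OF T] cinner_self)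
    also have "\<dots> \<le> norm (T ?z) * norm y" by (rule Re_cinner_le)
    also have "\<dots> \<le> norm T * norm ?z * norm y"
      by (intro mult_right_mono norm_blinfun) auto
    finally show ?thesis using False by (simp add: power2_eq_square mult.commute mult.left_commute)
  qed simp
qed simp

section \<open>Operators of rank one\<close>

lift_definition rank_one :: "'h::complex_hilbert_space \<Rightarrow> 'h \<Rightarrow> ('h \<Rightarrow>\<^sub>L 'h)"
  is "\<lambda>x y z. cinner z y *\<^sub>C x"
  by (intro bounded_linear_compose[OF scaleC.bounded_linear_left] cinner.bounded_linear_left)

lemma rank_one_apply: "blinfun_apply (rank_one x y) z = cinner z y *\<^sub>C x"
  by (simp add: rank_one.rep_eq)

text \<open>Bilinear over the reals only: the dependence on the second vector is conjugate-linear.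
  This is enough for the limit and continuity rules.\<close>

lemma bounded_bilinear_rank_one:
  "bounded_bilinear (rank_one :: 'h::complex_hilbert_space \<Rightarrow> 'h \<Rightarrow> _)"
proof
  show "\<exists>K. \<forall>x y :: 'h. norm (rank_one x y) \<le> norm x * norm y * K"
  proof (intro exI allI norm_blinfun_bound)
    fix x y z :: 'h
    have "norm (cinner z y) * norm x \<le> (norm z * norm y) * norm x"
      by (intro mult_right_mono norm_cinner_le) simp
    then show "norm (rank_one x y z) \<le> norm x * norm y * 1 * norm z"
      by (simp add: rank_one_apply norm_scaleC mult_ac)
  qed simp
qed (auto intro!: blinfun_eqI simp: rank_one_apply blinfun.add_left blinfun.scaleR_left
    cinner_add_right scaleC_add_left scaleC_add_right cinner_scaleR_right
    scaleC.scaleR_left scaleC.scaleR_right)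

interpretation rank_one:
  bounded_bilinear "rank_one :: 'h::complex_hilbert_space \<Rightarrow> 'h \<Rightarrow> ('h \<Rightarrow>\<^sub>L 'h)"
  by (rule bounded_bilinear_rank_one)

lemma norm_rank_one_le: "norm (rank_one x y) \<le> norm x * norm y"
proof (rule norm_blinfun_bound)
  fix z
  have "norm (cinner z y) * norm x \<le> (norm z * norm y) * norm x"
    by (intro mult_right_mono norm_cinner_le) simp
  then show "norm (rank_one x y z) \<le> norm x * norm y * norm z"
    by (simp add: rank_one_apply norm_scaleC mult_ac)
qed simp

lemma scaleC_op_rank_one: "scaleC_op c (rank_one x y) = rank_one (c *\<^sub>C x) y"
  by (rule blinfun_eqI) (simp add: scaleC_op.rep_eq rank_one_apply scaleC_scaleC mult.commute)

lemma rank_one_bounded_operators: "rank_one x y \<in> bounded_operators"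
  by (rule bounded_operatorsI) (simp add: rank_one_apply cinner_scaleC_left scaleC_scaleC)

lemma compose_rank_one:
  "T \<in> bounded_operators \<Longrightarrow> T o\<^sub>L rank_one x y = rank_one (T x) y"
  by (rule blinfun_eqI) (simp add: rank_one_apply bounded_operatorsD)

lemma compact_operators_subset: "T \<in> compact_operators \<Longrightarrow> T \<in> bounded_operators"
  by (simp add: compact_operators_def)

lemma compact_operatorsI:
  assumes "T \<in> bounded_operators" "compact K" "blinfun_apply T ` cball 0 1 \<subseteq> K"
  shows "T \<in> compact_operators"
proof -
  have "closure (blinfun_apply T ` cball 0 1) = K \<inter> closure (blinfun_apply T ` cball 0 1)"
    using assms(2,3) by (simp add: Int_absorb1 closure_minimal compact_imp_closed)
  also have "compact \<dots>" using assms(2) by (intro compact_Int_closed) auto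
  finally show ?thesis using assms(1) by (simp add: compact_operators_def)
qed

lemma compact_operators_compact_image:
  "T \<in> compact_operators \<Longrightarrow> compact (closure (blinfun_apply T ` cball 0 1))"
  by (simp add: compact_operators_def)

lemma rank_one_compact_operators: "rank_one x y \<in> compact_operators"
proof (rule compact_operatorsI[OF rank_one_bounded_operators])
  show "compact ((\<lambda>c. c *\<^sub>C x) ` cball 0 (norm y))"
    by (intro compact_continuous_image linear_continuous_on scaleC.bounded_linear_left compact_cball)
  have "norm (cinner z y) \<le> norm y" if "norm z \<le> 1" for z
    using norm_cinner_le[of z y] mult_right_mono[OF that norm_ge_zero[of y]] by simp
  then show "blinfun_apply (rank_one x y) ` cball 0 1 \<subseteq> (\<lambda>c. c *\<^sub>C x) ` cball 0 (norm y)"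
    by (auto simp: rank_one_apply)
qed

lemma compact_operators_diff:
  assumes S: "S \<in> compact_operators" and T: "T \<in> compact_operators"
  shows "S - T \<in> compact_operators"
proof (rule compact_operatorsI)
  let ?A = "closure (blinfun_apply S ` cball 0 1)" and ?B = "closure (blinfun_apply T ` cball 0 1)"
  show "compact {x - y | x y. x \<in> ?A \<and> y \<in> ?B}"
    by (intro compact_differences compact_operators_compact_image assms)
  show "blinfun_apply (S - T) ` cball 0 1 \<subseteq> {x - y | x y. x \<in> ?A \<and> y \<in> ?B}"
    by (auto simp: blinfun.diff_left)
      (metis (no_types, lifting) closure_subset image_eqI mem_cball_0 subsetD)
qed (use assms in \<open>auto intro: bounded_operators_diff compact_operators_subset\<close>)

lemma compact_operators_scaleR:
  assumes T: "T \<in> compact_operators"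
  shows "r *\<^sub>R T \<in> compact_operators"
proof (rule compact_operatorsI)
  let ?A = "closure (blinfun_apply T ` cball 0 1)"
  show "compact ((\<lambda>x. r *\<^sub>R x) ` ?A)"
    by (intro compact_scaling compact_operators_compact_image assms)
  show "blinfun_apply (r *\<^sub>R T) ` cball 0 1 \<subseteq> (\<lambda>x. r *\<^sub>R x) ` ?A"
    by (auto simp: blinfun.scaleR_left) (meson closure_subset imageI mem_cball_0 subsetD)
  show "r *\<^sub>R T \<in> bounded_operators"
    using compact_operators_subset[OF T]
    by (simp add: bounded_operators_def blinfun.scaleR_left scaleC.scaleR_right)
qed

section \<open>Functions vanishing at infinity\<close>

text \<open>The space L is an abstract topology rather than a type-class instance. Passing to the
  filters \<open>atin\<close> makes the ordinary calculus of limits available for functions on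
  it.\<close>

lemma continuous_map_euclidean_atin:
  "continuous_map \<tau> euclidean f \<longleftrightarrow> (\<forall>t\<in>topspace \<tau>. (f \<longlongrightarrow> f t) (atin \<tau> t))"
  by (simp add: continuous_map_atin)

text \<open>The value space is left open so that cut-offs (real values), vector fields (values in H)
  and operator-valued functions share one theory. As for the algebra itself, functions are extended
  by zero.\<close>

definition C0 :: "'l topology \<Rightarrow> ('l \<Rightarrow> 'b::real_normed_vector) set"
  where "C0 \<tau> = {f. continuous_map \<tau> euclidean f \<and>
    (\<forall>\<epsilon>>0. \<exists>K. compactin \<tau> K \<and> (\<forall>t\<in>topspace \<tau> - K. norm (f t) < \<epsilon>)) \<and>
    (\<forall>t. t \<notin> topspace \<tau> \<longrightarrow> f t = 0)}"

lemma C0_continuous: "f \<in> C0 \<tau> \<Longrightarrow> continuous_map \<tau> euclidean f"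
  by (simp add: C0_def)

lemma C0_outside: "f \<in> C0 \<tau> \<Longrightarrow> t \<notin> topspace \<tau> \<Longrightarrow> f t = 0"
  by (simp add: C0_def)

text \<open>The usual way below to prove membership in \<open>C0\<close>. The bound is required at
  every point of the type, so the zero extension is inherited as well.\<close>

lemma C0_dominated:
  assumes cont: "continuous_map \<tau> euclidean f" and g: "g \<in> C0 \<tau>"
    and le: "\<And>t. norm (f t) \<le> C * norm (g t)"
  shows "f \<in> C0 \<tau>"
proof -
  have "\<exists>K. compactin \<tau> K \<and> (\<forall>t\<in>topspace \<tau> - K. norm (f t) < \<epsilon>)" if "0 < \<epsilon>" for \<epsilon>
  proof -
    \<comment> \<open>\<open>\<bar>C\<bar> + 1\<close> keeps the denominator positive for every real
      \<open>C\<close>.\<close>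
    have "0 < \<epsilon> / (\<bar>C\<bar> + 1)" using that by (simp add: add_nonneg_pos)
    then obtain K where K: "compactin \<tau> K" "\<forall>t\<in>topspace \<tau> - K. norm (g t) < \<epsilon> / (\<bar>C\<bar> + 1)"
      using g unfolding C0_def by blast
    have "norm (f t) < \<epsilon>" if "t \<in> topspace \<tau> - K" for t
    proof -
      have "norm (f t) \<le> (\<bar>C\<bar> + 1) * norm (g t)"
        by (rule order.trans[OF le]) (auto intro: mult_right_mono)
      also have "\<dots> < (\<bar>C\<bar> + 1) * (\<epsilon> / (\<bar>C\<bar> + 1))"
        using K(2) that by (intro mult_strict_left_mono) auto
      also have "\<dots> = \<epsilon>" by (simp add: add_nonneg_pos less_imp_neq[symmetric])
      finally show ?thesis .
    qed
    with K(1) show ?thesis by blast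
  qed
  moreover have "f t = 0" if "t \<notin> topspace \<tau>" for t
    using le[of t] C0_outside[OF g that] by simp
  ultimately show ?thesis using cont by (simp add: C0_def)
qed

lemma C0_add:
  assumes f: "f \<in> C0 \<tau>" and g: "g \<in> C0 \<tau>"
  shows "(\<lambda>t. f t + g t) \<in> C0 \<tau>"
proof -
  have "\<exists>K. compactin \<tau> K \<and> (\<forall>t\<in>topspace \<tau> - K. norm (f t + g t) < \<epsilon>)" if "0 < \<epsilon>" for \<epsilon>
  proof -
    obtain K L where K: "compactin \<tau> K" "\<forall>t\<in>topspace \<tau> - K. norm (f t) < \<epsilon> / 2"
      and L: "compactin \<tau> L" "\<forall>t\<in>topspace \<tau> - L. norm (g t) < \<epsilon> / 2"
      using f g half_gt_zero[OF \<open>0 < \<epsilon>\<close>] unfolding C0_def by blast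
    have "norm (f t + g t) < \<epsilon>" if "t \<in> topspace \<tau> - (K \<union> L)" for t
    proof -
      have "norm (f t) < \<epsilon> / 2" "norm (g t) < \<epsilon> / 2" using that K(2) L(2) by auto
      then show ?thesis using norm_triangle_ineq[of "f t" "g t"] by simp
    qed
    with compactin_Un[OF K(1) L(1)] show ?thesis by blast
  qed
  moreover have "continuous_map \<tau> euclidean (\<lambda>t. f t + g t)"
    using C0_continuous[OF f] C0_continuous[OF g]
    by (auto simp: continuous_map_euclidean_atin intro: tendsto_add)
  ultimately show ?thesis using C0_outside[OF f] C0_outside[OF g] by (simp add: C0_def)
qed

lemma C0_scaleR: "f \<in> C0 \<tau> \<Longrightarrow> (\<lambda>t. r *\<^sub>R f t) \<in> C0 \<tau>"
  by (rule C0_dominated[where g = f and C = "\<bar>r\<bar>"])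
    (auto dest!: C0_continuous simp: continuous_map_euclidean_atin intro: tendsto_intros)

lemma C0_scaleR_const:
  assumes g: "g \<in> C0 \<tau>"
  shows "(\<lambda>s. g s *\<^sub>R x) \<in> C0 \<tau>"
  by (rule C0_dominated[OF _ g, where C = "norm x"])
    (use C0_continuous[OF g] in \<open>auto simp: mult.commute continuous_map_euclidean_atin
      intro!: tendsto_intros\<close>)

lemma C0_diff:
  assumes "f \<in> C0 \<tau>" "g \<in> C0 \<tau>"
  shows "(\<lambda>t. f t - g t) \<in> C0 \<tau>"
  using C0_add[OF assms(1) C0_scaleR[OF assms(2), of "-1"]] by simp

lemma C0_bounded:
  assumes f: "f \<in> C0 \<tau>"
  shows "\<exists>B. \<forall>t. norm (f t) \<le> B"
proof -
  obtain K where K: "compactin \<tau> K" "\<forall>t\<in>topspace \<tau> - K. norm (f t) < 1"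
    using f zero_less_one unfolding C0_def by blast
  have "compact (f ` K)"
    using image_compactin[OF K(1) C0_continuous[OF f]] by simp
  then obtain B where B: "\<And>t. t \<in> K \<Longrightarrow> norm (f t) \<le> B"
    by (meson bounded_iff compact_imp_bounded imageI)
  have "norm (f t) \<le> max B 1" for t
  proof (cases "t \<in> K")
    case False
    then have "norm (f t) < 1"
      using K(2) C0_outside[OF f, of t] by (cases "t \<in> topspace \<tau>") auto
    then show ?thesis by simp
  qed (use B in \<open>simp add: le_max_iff_disj\<close>)
  then show ?thesis by blast
qed

text \<open>Supplies the limit function in the gliding hump argument.\<close>

lemma C0_uniform_limit:
  assumes f: "\<And>n. f n \<in> C0 \<tau>"
    and lim: "\<And>\<epsilon>. 0 < \<epsilon> \<Longrightarrow> \<exists>n::nat. \<forall>t. norm (f n t - g t) < \<epsilon>"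
  shows "g \<in> C0 \<tau>"
proof -
  have "\<exists>K. compactin \<tau> K \<and> (\<forall>t\<in>topspace \<tau> - K. norm (g t) < \<epsilon>)" if "0 < \<epsilon>" for \<epsilon>
  proof -
    obtain n where n: "\<And>t. norm (f n t - g t) < \<epsilon> / 2" using lim[of "\<epsilon> / 2"] \<open>0 < \<epsilon>\<close> by auto
    obtain K where K: "compactin \<tau> K" "\<And>t. t\<in>topspace \<tau> - K \<Longrightarrow> norm (f n t) < \<epsilon> / 2"
      using f[of n] half_gt_zero[OF \<open>0 < \<epsilon>\<close>] unfolding C0_def by blast
    have "norm (g t) < \<epsilon>" if "t \<in> topspace \<tau> - K" for t
      using n[of t] K(2)[OF that] norm_triangle_ineq4[of "f n t" "f n t - g t"] by simp
    with K(1) show ?thesis by blast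
  qed
  moreover have "g t = 0" if "t \<notin> topspace \<tau>" for t
  proof (rule ccontr)
    assume "g t \<noteq> 0"
    then obtain n where "norm (f n t - g t) < norm (g t)" using lim[of "norm (g t)"] by auto
    then show False by (simp add: C0_outside[OF f that])
  qed
  moreover have "(g \<longlongrightarrow> g t) (atin \<tau> t)" if "t \<in> topspace \<tau>" for t
  proof (rule tendstoI)
    fix \<epsilon> :: real assume "0 < \<epsilon>"
    then obtain n where n: "\<And>t. norm (f n t - g t) < \<epsilon> / 3" using lim[of "\<epsilon> / 3"] by auto
    have "(f n \<longlongrightarrow> f n t) (atin \<tau> t)"
      using C0_continuous[OF f] that by (auto simp: continuous_map_euclidean_atin)
    then have "eventually (\<lambda>s. dist (f n s) (f n t) < \<epsilon> / 3) (atin \<tau> t)"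
      using \<open>0 < \<epsilon>\<close> by (intro tendstoD) simp_all
    then show "eventually (\<lambda>s. dist (g s) (g t) < \<epsilon>) (atin \<tau> t)"
    proof eventually_elim
      case (elim s)
      show ?case
        by (rule dist_triangle_third[of "g s" "f n s" \<epsilon> "f n t" "g t"])
          (use elim n[of s] n[of t] in \<open>simp_all add: dist_norm norm_minus_commute\<close>)
    qed
  qed
  ultimately show ?thesis by (simp add: C0_def continuous_map_euclidean_atin)
qed

text \<open>A plateau, and not merely the value 1 at t, is demanded because continuity at t is later
  read off from formulas valid at all nearby points.\<close>

lemma C0_bump:
  assumes lc: "locally_compact_space \<tau>" and "Hausdorff_space \<tau>" and t: "t \<in> topspace \<tau>"
  obtains g :: "'l \<Rightarrow> real" and U where "g \<in> C0 \<tau>" "\<And>s. 0 \<le> g s" "\<And>s. g s \<le> 1"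
    "openin \<tau> U" "t \<in> U" "\<And>s. s \<in> U \<Longrightarrow> g s = 1"
proof -
  have "completely_regular_space \<tau>"
    using assms by (simp add: locally_compact_regular_imp_completely_regular_space)
  obtain V K where V: "openin \<tau> V" "compactin \<tau> K" "t \<in> V" "V \<subseteq> K"
    using lc t unfolding locally_compact_space_def by meson
  have "closedin \<tau> (topspace \<tau> - V)" "t \<in> topspace \<tau> - (topspace \<tau> - V)" using V t by auto
  then obtain f :: "'l \<Rightarrow> real" where f: "continuous_map \<tau> (top_of_set {0..1}) f" "f t = 0"
      "f ` (topspace \<tau> - V) \<subseteq> {1}"
    using \<open>completely_regular_space \<tau>\<close> unfolding completely_regular_space_def by metis
  have fc: "continuous_map \<tau> euclidean f" and f01: "\<And>s. s \<in> topspace \<tau> \<Longrightarrow> f s \<in> {0..1}"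
    using f(1) by (auto simp: continuous_map_in_subtopology)
  \<comment> \<open>Complete regularity gives \<open>f\<close> with value 0 at \<open>t\<close> and
    1 outside \<open>V\<close>. Doubling \<open>1 - f\<close> and truncating at 1 creates the
    plateau where \<open>f < 1/2\<close>, while the result still vanishes off the compact set
    \<open>K\<close>.\<close>
  define g where "g s = (if s \<in> topspace \<tau> then min 1 (2 * (1 - f s)) else 0)" for s
  define U where "U = {s \<in> topspace \<tau>. f s \<in> {..<1/2}}"
  show thesis
  proof (rule that[of g U])
    have "continuous_map \<tau> euclidean (\<lambda>s. min 1 (2 * (1 - f s)))"
      using fc by (auto simp: continuous_map_euclidean_atin intro!: tendsto_intros)
    then have "continuous_map \<tau> euclidean g"
      by (rule continuous_map_eq) (simp add: g_def)
    moreover have "g s = 0" if "s \<in> topspace \<tau> - K" for s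
    proof -
      have "f s = 1" using that f(3) V(4) by auto
      then show ?thesis by (simp add: g_def)
    qed
    ultimately show "g \<in> C0 \<tau>"
      using V(2) by (auto simp: C0_def intro!: exI[of _ K]) (simp add: g_def)
    show "openin \<tau> U" unfolding U_def
      by (rule openin_continuous_map_preimage[OF fc]) simp
  qed (use f01 f(2) t in \<open>auto simp: g_def U_def\<close>)
qed

section \<open>Functions with compact operators as values\<close>

lemma C0_compact_operators_iff:
  "X \<in> C0_compact_operators \<tau> \<longleftrightarrow> X \<in> C0 \<tau> \<and> (\<forall>t\<in>topspace \<tau>. X t \<in> compact_operators)"
  by (auto simp: C0_compact_operators_def C0_def)

lemma C0_compact_operators_bounded_operators:
  "X \<in> C0_compact_operators \<tau> \<Longrightarrow> X t \<in> bounded_operators"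
  by (cases "t \<in> topspace \<tau>")
    (auto simp: C0_compact_operators_iff compact_operators_subset bounded_operators_0 C0_outside)

lemma C0_compact_operators_diff:
  assumes "X \<in> C0_compact_operators \<tau>" "Y \<in> C0_compact_operators \<tau>"
  shows "(\<lambda>t. X t - Y t) \<in> C0_compact_operators \<tau>"
  using assms by (simp add: C0_compact_operators_iff C0_diff compact_operators_diff)

lemma rank_one_C0_compact_operators:
  assumes v: "v \<in> C0 \<tau>"
  shows "(\<lambda>t. rank_one (v t) y) \<in> C0_compact_operators \<tau>"
proof -
  have "(\<lambda>t. rank_one (v t) y) \<in> C0 \<tau>"
  proof (rule C0_dominated[OF _ v])
    show "continuous_map \<tau> euclidean (\<lambda>t. rank_one (v t) y)"
      using C0_continuous[OF v] by (auto simp: continuous_map_euclidean_atin intro!: rank_one.tendsto)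
    show "norm (rank_one (v t) y) \<le> norm y * norm (v t)" for t
      using norm_rank_one_le[of "v t" y] by (simp add: mult.commute)
  qed
  then show ?thesis by (simp add: C0_compact_operators_iff rank_one_compact_operators)
qed

section \<open>Uniform boundedness\<close>

text \<open>A gliding hump argument that uses no Baire category: moving by \<open>\<plusminus> v\<close> from any point, one of the
  two signs makes the value of a linear map at least as large as its value at \<open>v\<close>.\<close>

lemma C0_uniform_boundedness:
  fixes \<phi> :: "'i \<Rightarrow> ('l \<Rightarrow> 'b::banach) \<Rightarrow> 'c::real_normed_vector"
  assumes add: "\<And>i f g. i \<in> I \<Longrightarrow> f \<in> C0 \<tau> \<Longrightarrow> g \<in> C0 \<tau> \<Longrightarrow> \<phi> i (\<lambda>t. f t + g t) = \<phi> i f + \<phi> i g"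
    and scale: "\<And>i r f. i \<in> I \<Longrightarrow> f \<in> C0 \<tau> \<Longrightarrow> \<phi> i (\<lambda>t. r *\<^sub>R f t) = r *\<^sub>R \<phi> i f"
    and bounded: "\<And>i. i \<in> I \<Longrightarrow> \<exists>M. \<forall>f\<in>C0 \<tau>. (\<forall>t. norm (f t) \<le> 1) \<longrightarrow> norm (\<phi> i f) \<le> M"
    and pointwise: "\<And>f. f \<in> C0 \<tau> \<Longrightarrow> \<exists>M. \<forall>i\<in>I. norm (\<phi> i f) \<le> M"
  shows "\<exists>M. \<forall>i\<in>I. \<forall>f\<in>C0 \<tau>. (\<forall>t. norm (f t) \<le> 1) \<longrightarrow> norm (\<phi> i f) \<le> M"
proof (rule ccontr)
  assume unbounded: "\<not> ?thesis"
  define B where "B = {f \<in> C0 \<tau>. \<forall>t. norm (f t :: 'b) \<le> 1}"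
  define N where "N i = (SUP f\<in>B. norm (\<phi> i f))" for i
  have bdd: "bdd_above ((\<lambda>f. norm (\<phi> i f)) ` B)" if "i \<in> I" for i
  proof -
    obtain M where "\<forall>f\<in>C0 \<tau>. (\<forall>t. norm (f t) \<le> 1) \<longrightarrow> norm (\<phi> i f) \<le> M"
      using bounded[OF \<open>i \<in> I\<close>] by blast
    then show ?thesis by (intro bdd_aboveI2[where M = M]) (simp add: B_def)
  qed
  have le_N: "norm (\<phi> i f) \<le> N i" if "i \<in> I" "f \<in> B" for i f
    unfolding N_def using bdd that by (intro cSUP_upper)
  have le_N_scaled: "norm (\<phi> i f) \<le> N i * c"
    if "i \<in> I" "f \<in> C0 \<tau>" "\<And>t. norm (f t) \<le> c" "0 < c" for i f c
  proof -
    have "(\<lambda>t. inverse c *\<^sub>R f t) \<in> B"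
      using that C0_scaleR[of f \<tau> "inverse c"] by (simp add: B_def field_simps)
    from le_N[OF that(1) this] that show ?thesis by (simp add: scale field_simps)
  qed
  \<comment> \<open>\<open>N i\<close> is the norm of \<open>\<phi> i\<close>. The growth
    \<open>4^n\<close> beats the shrinking step size \<open>(1/3)^n\<close>. The factor 3/4 allows
    for a supremum that is not attained, and it exceeds the share 1/2 that all later steps together
    can destroy.\<close>
  have step: "\<exists>y. y \<in> C0 \<tau> \<and> (\<forall>t. norm (y t - x t) \<le> (1/3)^n) \<and>
      (\<exists>i\<in>I. 4^n \<le> N i \<and> 3/4 * (1/3)^n * N i \<le> norm (\<phi> i y))"
    if x: "x \<in> C0 \<tau>" for x and n :: nat
  proof -
    obtain i f where i: "i \<in> I" "f \<in> B" "4^n < norm (\<phi> i f)"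
      using unbounded unfolding B_def by (auto simp: not_le) (metis not_le)
    then have Ni: "4^n < N i" using le_N by force
    then have "3/4 * N i < N i" using zero_less_power[of "4::real" n] by linarith
    then obtain h where h: "h \<in> B" "3/4 * N i < norm (\<phi> i h)"
      using bdd[OF i(1)] i(2) less_cSUP_iff[of B "\<lambda>f. norm (\<phi> i f)"] unfolding N_def by blast
    define v where "v s = (\<lambda>t. (s * (1/3)^n) *\<^sub>R h t)" for s :: real
    have h0: "h \<in> C0 \<tau>" using h by (simp add: B_def)
    have v: "v s \<in> C0 \<tau>" for s
      unfolding v_def by (intro C0_scaleR h0)
    have nv: "norm (v s t) \<le> (1/3)^n" if "\<bar>s\<bar> = 1" for s t
      using h(1) that by (auto simp: v_def B_def abs_mult intro: mult_left_le)
    define y where "y s = (\<lambda>t. x t + v s t)" for s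
    have y: "y s \<in> C0 \<tau>" for s unfolding y_def by (intro C0_add x v)
    have "\<phi> i (y s) = \<phi> i x + (s * (1/3)^n) *\<^sub>R \<phi> i h" for s
      using add[OF i(1) x v, of s] scale[OF i(1) h0] by (simp add: y_def v_def)
    then have "\<phi> i (y 1) - \<phi> i (y (-1)) = (2 * (1/3)^n) *\<^sub>R \<phi> i h"
      by (simp flip: scaleR_add_left)
    then have "norm (\<phi> i (y 1) - \<phi> i (y (-1))) = 2 * ((1/3)^n * norm (\<phi> i h))"
      by simp
    then have "2 * ((1/3)^n * norm (\<phi> i h)) \<le> norm (\<phi> i (y 1)) + norm (\<phi> i (y (-1)))"
      using norm_triangle_ineq4[of "\<phi> i (y 1)" "\<phi> i (y (-1))"] by linarith
    moreover have "(1/3)^n * (3/4 * N i) \<le> (1/3)^n * norm (\<phi> i h)"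
      using h(2) by (intro mult_left_mono) auto
    ultimately have "3/4 * (1/3)^n * N i \<le> norm (\<phi> i (y 1)) \<or>
        3/4 * (1/3)^n * N i \<le> norm (\<phi> i (y (-1)))"
      by linarith
    then obtain s where s: "\<bar>s\<bar> = 1" "3/4 * (1/3)^n * N i \<le> norm (\<phi> i (y s))"
      by (metis abs_1 abs_minus_cancel)
    have "norm (y s t - x t) \<le> (1/3)^n" for t using nv[OF s(1)] by (simp add: y_def)
    then show ?thesis using y s(2) i(1) Ni by (meson less_imp_le)
  qed
  have "(\<lambda>t. 0) \<in> C0 \<tau>" by (auto simp: C0_def intro: exI[of _ "{}"])
  then have "\<exists>X. \<forall>n::nat. X n \<in> C0 \<tau> \<and> ((\<forall>t. norm (X (Suc n) t - X n t) \<le> (1/3)^n) \<and>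
      (\<exists>i\<in>I. 4^n \<le> N i \<and> 3/4 * (1/3)^n * N i \<le> norm (\<phi> i (X (Suc n)))))"
    by (intro dependent_nat_choice) (use step in blast)+
  then obtain X where X: "\<And>n. X n \<in> C0 \<tau>"
    and Xstep: "\<And>n t. norm (X (Suc n) t - X n t) \<le> (1/3)^n"
    and Xbig: "\<And>n. \<exists>i\<in>I. 4^n \<le> N i \<and> 3/4 * (1/3)^n * N i \<le> norm (\<phi> i (X (Suc n)))"
    by blast
  \<comment> \<open>Partial sums of the geometric series with ratio 1/3; the subtracted term makes
    the induction close.\<close>
  have tail: "norm (X m t - X n t) \<le> 3/2 * ((1/3)^n - (1/3)^m)" if "n \<le> m" for m n t
    using that
  proof (induction m rule: dec_induct)
    case (step m)
    have "norm (X (Suc m) t - X n t) \<le> norm (X (Suc m) t - X m t) + norm (X m t - X n t)"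
      by (rule norm_diff_triangle_ineq[of _ "X m t" "X m t", simplified])
    then show ?case using Xstep[of m t] step.IH by simp
  qed simp
  have tail': "norm (X m t - X n t) \<le> 3/2 * (1/3)^n" if "n \<le> m" for m n t
    using tail[OF that, of t] by (rule order.trans) simp
  have small: "\<exists>n. 3/2 * (1/3)^n < \<epsilon>" if "0 < \<epsilon>" for \<epsilon> :: real
  proof -
    obtain n where "(1/3)^n < 2/3 * \<epsilon>"
      using real_arch_pow_inv[of "2/3 * \<epsilon>" "1/3"] \<open>0 < \<epsilon>\<close> by auto
    then have "3/2 * (1/3)^n < \<epsilon>" by simp
    then show ?thesis by blast
  qed
  have "Cauchy (\<lambda>n. X n t)" for t
  proof (rule CauchyI)
    fix \<epsilon> :: real assume "0 < \<epsilon>"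
    then obtain n :: nat where n: "3/2 * (1/3)^n < \<epsilon> / 2" using small[of "\<epsilon> / 2"] by auto
    have "norm (X k t - X m t) < \<epsilon>" if "n \<le> k" "n \<le> m" for k m
      using tail'[OF that(1), of t] tail'[OF that(2), of t] n
        norm_triangle_ineq4[of "X k t - X n t" "X m t - X n t"] by simp
    then show "\<exists>M. \<forall>m\<ge>M. \<forall>n\<ge>M. norm (X m t - X n t) < \<epsilon>" by blast
  qed
  then have lim_X: "(\<lambda>n. X n t) \<longlonglongrightarrow> lim (\<lambda>n. X n t)" for t
    by (simp add: Cauchy_convergent convergent_LIMSEQ_iff[symmetric])
  define x where "x t = lim (\<lambda>n. X n t)" for t
  have lim: "(\<lambda>n. X n t) \<longlonglongrightarrow> x t" for t using lim_X by (simp add: x_def)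
  have xX: "norm (x t - X n t) \<le> 3/2 * (1/3)^n" for t n
  proof (rule LIMSEQ_le_const2)
    show "(\<lambda>m. norm (X m t - X n t)) \<longlonglongrightarrow> norm (x t - X n t)"
      by (intro tendsto_intros lim)
  qed (use tail' in blast)
  have x: "x \<in> C0 \<tau>"
    using X
  proof (rule C0_uniform_limit)
    fix \<epsilon> :: real assume "0 < \<epsilon>"
    then obtain n :: nat where n: "3/2 * (1/3)^n < \<epsilon>" using small by auto
    have "norm (X n t - x t) < \<epsilon>" for t
      using xX[of t n] n by (simp add: norm_minus_commute)
    then show "\<exists>n. \<forall>t. norm (X n t - x t) < \<epsilon>" by blast
  qed
  obtain M where M: "\<And>i. i \<in> I \<Longrightarrow> norm (\<phi> i x) \<le> M" using pointwise[OF x] by blast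
  obtain n :: nat where n: "4 * M < (4/3)^n" using real_arch_pow[of "4/3" "4 * M"] by auto
  obtain i where i: "i \<in> I" "4^n \<le> N i" "3/4 * (1/3)^n * N i \<le> norm (\<phi> i (X (Suc n)))"
    using Xbig by blast
  \<comment> \<open>The steps after number \<open>n\<close> add up to at most 3/2 times
    \<open>(1/3)^(n+1)\<close>, that is 1/2 times \<open>(1/3)^n\<close>. A quarter of
    \<open>(1/3)^n * N i\<close> survives at the limit \<open>x\<close>, which is at least
    \<open>(4/3)^n / 4\<close>.\<close>
  have "norm (\<phi> i (\<lambda>t. x t - X (Suc n) t)) \<le> N i * (1/2 * (1/3)^n)"
    using xX[of _ "Suc n"] by (intro le_N_scaled i C0_diff x X) auto
  moreover have "\<phi> i x = \<phi> i (\<lambda>t. x t - X (Suc n) t) + \<phi> i (X (Suc n))"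
    using add[OF i(1) C0_diff[OF x X] X, of "Suc n" "Suc n"] by simp
  ultimately have "norm (\<phi> i (X (Suc n))) \<le> norm (\<phi> i x) + N i * (1/2 * (1/3)^n)"
    using norm_triangle_ineq4[of "\<phi> i x" "\<phi> i (\<lambda>t. x t - X (Suc n) t)"] by simp
  then have "3/4 * ((1/3)^n * N i) \<le> M + 1/2 * ((1/3)^n * N i)"
    using i(3) M[OF i(1)] by (simp add: mult_ac)
  then have "(1/3)^n * N i \<le> 4 * M" by linarith
  moreover have "(1/3)^n * 4^n \<le> (1/3)^n * N i" using i(2) by (intro mult_left_mono) auto
  moreover have "(1/3)^n * 4^n = (4/3 :: real)^n" by (simp flip: power_mult_distrib)
  ultimately show False using n by linarith
qed

section \<open>Derivations are fibrewise inner\<close>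

text \<open>The square root splitting \<open>X = f Y\<close> with \<open>f = \<surd>\<parallel>X\<parallel>\<close> gives \<open>D (X W) = D (Y (f W))\<close> for every \<open>W\<close>.
  At a zero of \<open>X\<close> both \<open>f\<close> and \<open>Y\<close> vanish, so that only \<open>D X W\<close> is left.\<close>

lemma derivation_C0_local_zero:
  fixes D :: "('l \<Rightarrow> ('h::complex_hilbert_space \<Rightarrow>\<^sub>L 'h)) \<Rightarrow> ('l \<Rightarrow> ('h \<Rightarrow>\<^sub>L 'h))"
  assumes lc: "locally_compact_space \<tau>" "Hausdorff_space \<tau>" and D: "derivation_C0 \<tau> D"
    and X: "X \<in> C0_compact_operators \<tau>" and X0: "X t = 0"
  shows "D X t = 0"
proof (cases "t \<in> topspace \<tau>")
  case False
  then show ?thesis using D X by (auto simp: derivation_C0_def C0_compact_operators_def)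
next
  case t: True
  have X': "X \<in> C0 \<tau>" using X by (simp add: C0_compact_operators_iff)
  define f where "f s = sqrt (norm (X s))" for s
  \<comment> \<open>At a zero of \<open>X\<close> the convention \<open>inverse 0 = 0\<close> is
    harmless, since the factor \<open>X s\<close> vanishes anyway.\<close>
  define Y where "Y s = inverse (f s) *\<^sub>R X s" for s
  have norm_Y: "norm (Y s) = f s" for s
    by (simp add: Y_def f_def real_sqrt_ge_zero flip: divide_inverse_commute)
       (metis real_div_sqrt norm_ge_zero)
  have fY: "f s *\<^sub>R Y s = X s" for s
    by (cases "X s = 0") (simp_all add: Y_def f_def)
  have lim_X: "(X \<longlongrightarrow> X s) (atin \<tau> s)" if "s \<in> topspace \<tau>" for s
    using C0_continuous[OF X'] that by (simp add: continuous_map_euclidean_atin)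
  have lim_f: "(f \<longlongrightarrow> f s) (atin \<tau> s)" if "s \<in> topspace \<tau>" for s
    unfolding f_def by (intro tendsto_intros lim_X that)
  have Y': "Y \<in> C0 \<tau>"
  proof -
    have "(Y \<longlongrightarrow> Y s) (atin \<tau> s)" if s: "s \<in> topspace \<tau>" for s
    proof (cases "X s = 0")
      case False
      then show ?thesis unfolding Y_def
        by (intro tendsto_intros lim_X lim_f s) (simp add: f_def)
    next
      case True
      then have "Y s = 0" "f s = 0" by (simp_all add: Y_def f_def)
      \<comment> \<open>The quotient rule fails at a zero of \<open>X\<close>, but the norm of
        \<open>Y\<close> is the continuous function \<open>f\<close>, which vanishes there.\<close>
      moreover have "((\<lambda>u. norm (Y u)) \<longlongrightarrow> 0) (atin \<tau> s)"
        using lim_f[OF s] \<open>f s = 0\<close> by (simp add: norm_Y)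
      ultimately show ?thesis by (simp add: tendsto_norm_zero_iff)
    qed
    moreover have "\<exists>K. compactin \<tau> K \<and> (\<forall>s\<in>topspace \<tau> - K. norm (Y s) < \<epsilon>)" if "0 < \<epsilon>" for \<epsilon>
    proof -
      have "0 < \<epsilon>\<^sup>2" using that by simp
      then obtain K where K: "compactin \<tau> K" "\<forall>s\<in>topspace \<tau> - K. norm (X s) < \<epsilon>\<^sup>2"
        using X' unfolding C0_def by blast
      then have "\<forall>s\<in>topspace \<tau> - K. norm (Y s) < \<epsilon>"
        using \<open>0 < \<epsilon>\<close> by (auto simp: norm_Y f_def intro: real_less_lsqrt)
      with K(1) show ?thesis by blast
    qed
    ultimately show ?thesis
      using C0_outside[OF X'] by (simp add: C0_def continuous_map_euclidean_atin) (simp add: Y_def)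
  qed
  have Y: "Y \<in> C0_compact_operators \<tau>"
    using X Y' by (auto simp: C0_compact_operators_iff Y_def intro: compact_operators_scaleR)
  obtain B where B: "\<And>s. norm (Y s) \<le> B" using C0_bounded[OF Y'] by blast
  obtain g U where g: "g \<in> C0 \<tau>" "\<And>s. s \<in> U \<Longrightarrow> g s = (1::real)" "t \<in> U"
    using C0_bump[OF lc t] by metis
  have zero: "D X t x = 0" for x
  proof (cases "x = 0")
    case False
    define v where "v s = g s *\<^sub>R x" for s
    have v: "v \<in> C0 \<tau>"
      unfolding v_def by (rule C0_scaleR_const[OF g(1)])
    \<comment> \<open>At \<open>t\<close> this is x (x) x, which sends \<open>x\<close> to a
      positive multiple of itself; so \<open>D X t o\<^sub>L W t = 0\<close> annihilates
      \<open>D X t x\<close>.\<close>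
    define W where "W s = rank_one (v s) x" for s
    have W: "W \<in> C0_compact_operators \<tau>"
      unfolding W_def using v by (rule rank_one_C0_compact_operators)
    define V where "V s = f s *\<^sub>R W s" for s
    \<comment> \<open>\<open>f\<close> is the norm of \<open>Y\<close>, hence bounded by
      \<open>B\<close>, and multiplication by it stays in the algebra.\<close>
    have "V \<in> C0 \<tau>"
    proof (rule C0_dominated[where g = W and C = B])
      show "continuous_map \<tau> euclidean V"
        using W unfolding V_def
        by (auto simp: C0_compact_operators_iff C0_def continuous_map_euclidean_atin
            intro!: tendsto_intros lim_f)
      show "norm (V s) \<le> B * norm (W s)" for s
        using B[of s] norm_ge_zero[of "Y s"] by (simp add: V_def norm_Y mult_right_mono)
    qed (use W in \<open>simp add: C0_compact_operators_iff\<close>)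
    then have V: "V \<in> C0_compact_operators \<tau>"
      using W by (auto simp: C0_compact_operators_iff V_def intro: compact_operators_scaleR)
    have Leibniz: "D (\<lambda>s. P s o\<^sub>L Q s) = (\<lambda>s. (D P s o\<^sub>L Q s) + (P s o\<^sub>L D Q s))"
      if "P \<in> C0_compact_operators \<tau>" "Q \<in> C0_compact_operators \<tau>" for P Q
      using D that by (simp add: derivation_C0_def)
    have "X s o\<^sub>L W s = Y s o\<^sub>L V s" for s
      by (rule blinfun_eqI) (simp add: V_def blinfun.scaleR_left blinfun.scaleR_right
          flip: fY)
    then have "(\<lambda>s. X s o\<^sub>L W s) = (\<lambda>s. Y s o\<^sub>L V s)" by blast
    then have "(D X t o\<^sub>L W t) + (X t o\<^sub>L D W t) = (D Y t o\<^sub>L V t) + (Y t o\<^sub>L D V t)"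
      using Leibniz[OF X W] Leibniz[OF Y V] by metis
    moreover have "V t = 0" "Y t = 0" using X0 norm_Y[of t] by (simp_all add: V_def f_def)
    ultimately have "D X t o\<^sub>L W t = 0"
      using X0 by simp
    then have "D X t (W t x) = 0"
      by (metis blinfun.zero_left blinfun_apply_blinfun_compose)
    moreover have "W t x = (norm x)\<^sup>2 *\<^sub>R x"
      by (simp add: W_def v_def g rank_one_apply cinner_self scaleR_scaleC[where 'a='h] scaleC_one)
    ultimately show ?thesis using False by (simp add: blinfun.scaleR_right)
  qed simp
  show ?thesis by (rule blinfun_eqI) (simp add: zero)
qed

section \<open>Locality and cut-offs\<close>

locale C0_derivation =
  fixes \<tau> :: "'l topology"
    and D :: "('l \<Rightarrow> ('h::complex_hilbert_space \<Rightarrow>\<^sub>L 'h)) \<Rightarrow> ('l \<Rightarrow> ('h \<Rightarrow>\<^sub>L 'h))"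
  assumes locally_compact: "locally_compact_space \<tau>" and Hausdorff: "Hausdorff_space \<tau>"
    and derivation: "derivation_C0 \<tau> D"
begin

lemma D_closed: "X \<in> C0_compact_operators \<tau> \<Longrightarrow> D X \<in> C0_compact_operators \<tau>"
  using derivation by (simp add: derivation_C0_def)

lemma D_add:
  "X \<in> C0_compact_operators \<tau> \<Longrightarrow> Y \<in> C0_compact_operators \<tau> \<Longrightarrow>
    D (\<lambda>t. X t + Y t) t = D X t + D Y t"
  using derivation by (simp add: derivation_C0_def)

lemma D_scaleC:
  "X \<in> C0_compact_operators \<tau> \<Longrightarrow> D (\<lambda>t. scaleC_op c (X t)) t = scaleC_op c (D X t)"
  using derivation by (simp add: derivation_C0_def)

lemma D_compose:
  "X \<in> C0_compact_operators \<tau> \<Longrightarrow> Y \<in> C0_compact_operators \<tau> \<Longrightarrow>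
    D (\<lambda>t. X t o\<^sub>L Y t) t = (D X t o\<^sub>L Y t) + (X t o\<^sub>L D Y t)"
  using derivation by (simp add: derivation_C0_def)

text \<open>This gives the freedom to choose, for a prescribed operator at t, whichever extension to
  an element of the algebra is convenient.\<close>

lemma D_local:
  assumes X: "X \<in> C0_compact_operators \<tau>" and Y: "Y \<in> C0_compact_operators \<tau>" and "X t = Y t"
  shows "D X t = D Y t"
proof -
  have XY: "(\<lambda>s. X s - Y s) \<in> C0_compact_operators \<tau>" using X Y by (rule C0_compact_operators_diff)
  have "D X t = D (\<lambda>s. (X s - Y s) + Y s) t" by simp
  also have "\<dots> = D (\<lambda>s. X s - Y s) t + D Y t" by (rule D_add[OF XY Y])
  also have "D (\<lambda>s. X s - Y s) t = 0"
    using locally_compact Hausdorff derivation XY by (rule derivation_C0_local_zero) (simp add: assms)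
  finally show ?thesis by simp
qed

text \<open>For t outside the space the zero function is a witness, so the choice of a cut-off can
  be made for all t and its basic bounds hold unconditionally.\<close>

lemma bump_exists:
  "\<exists>g::'l \<Rightarrow> real. g \<in> C0 \<tau> \<and> (\<forall>s. 0 \<le> g s \<and> g s \<le> 1) \<and>
    (t \<in> topspace \<tau> \<longrightarrow> (\<exists>U. openin \<tau> U \<and> t \<in> U \<and> (\<forall>s\<in>U. g s = 1)))"
proof (cases "t \<in> topspace \<tau>")
  case True
  then show ?thesis using C0_bump[OF locally_compact Hausdorff] by metis
next
  case False
  then show ?thesis by (intro exI[of _ "\<lambda>_. 0"]) (auto simp: C0_def intro: exI[of _ "{}"])
qed

definition bump :: "'l \<Rightarrow> 'l \<Rightarrow> real"
  where "bump t = (SOME g. g \<in> C0 \<tau> \<and> (\<forall>s. 0 \<le> g s \<and> g s \<le> 1) \<and>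
    (t \<in> topspace \<tau> \<longrightarrow> (\<exists>U. openin \<tau> U \<and> t \<in> U \<and> (\<forall>s\<in>U. g s = 1))))"

lemma
  shows bump_C0: "bump t \<in> C0 \<tau>"
    and bump_nonneg: "0 \<le> bump t s"
    and bump_le_1: "bump t s \<le> 1"
    and bump_nhd: "t \<in> topspace \<tau> \<Longrightarrow> \<exists>U. openin \<tau> U \<and> t \<in> U \<and> (\<forall>s\<in>U. bump t s = 1)"
  unfolding bump_def using someI_ex[OF bump_exists[of t]] by blast+

lemma bump_self: "t \<in> topspace \<tau> \<Longrightarrow> bump t t = 1"
  using bump_nhd by blast

lemma bump_scaleR_C0: "(\<lambda>s. bump t s *\<^sub>R x) \<in> C0 \<tau>"
  by (rule C0_scaleR_const[OF bump_C0])

definition bump_rank_one :: "'l \<Rightarrow> 'h \<Rightarrow> 'h \<Rightarrow> 'l \<Rightarrow> ('h \<Rightarrow>\<^sub>L 'h)"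
  where "bump_rank_one t x y = (\<lambda>s. rank_one (bump t s *\<^sub>R x) y)"

lemma bump_rank_one_C0: "bump_rank_one t x y \<in> C0_compact_operators \<tau>"
  unfolding bump_rank_one_def by (rule rank_one_C0_compact_operators[OF bump_scaleR_C0])

lemma bump_rank_one_eq: "bump t s = 1 \<Longrightarrow> bump_rank_one t x y s = rank_one x y"
  by (simp add: bump_rank_one_def)

end

text \<open>The vector \<open>e\<close> is a unit vector unless the space is trivial, in which case \<open>e = 0\<close>.\<close>

locale C0_derivation_vector = C0_derivation \<tau> D
  for \<tau> :: "'l topology"
    and D :: "('l \<Rightarrow> ('h::complex_hilbert_space \<Rightarrow>\<^sub>L 'h)) \<Rightarrow> ('l \<Rightarrow> ('h \<Rightarrow>\<^sub>L 'h))" +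
  fixes e :: 'h
  assumes norm_e: "norm e \<le> 1" and cinner_e: "\<And>x :: 'h. cinner e e *\<^sub>C x = x"
begin

definition implement :: "'l \<Rightarrow> 'h \<Rightarrow> 'h"
  where "implement t x = D (bump_rank_one t x e) t e"

text \<open>By locality every element of the algebra with value x (x) e at t can replace the cut-off
  in the definition. It is used for products, for varying vector fields, and for cut-offs centred at
  a neighbouring point.\<close>

lemma D_eq_implement:
  assumes X: "X \<in> C0_compact_operators \<tau>" and t: "t \<in> topspace \<tau>" and "X t = rank_one x e"
  shows "D X t e = implement t x"
  unfolding implement_def using D_local[OF X bump_rank_one_C0, of t t x e] assms
  by (simp add: bump_rank_one_eq bump_self)

lemma implement_add:
  assumes t: "t \<in> topspace \<tau>"
  shows "implement t (x + y) = implement t x + implement t y"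
proof -
  let ?X = "bump_rank_one t x e" and ?Y = "bump_rank_one t y e"
  have "(\<lambda>s. ?X s + ?Y s) = bump_rank_one t (x + y) e"
    by (simp add: bump_rank_one_def scaleR_add_right rank_one.add_left)
  then show ?thesis
    using D_add[OF bump_rank_one_C0 bump_rank_one_C0, of t x e t y e t]
    by (simp add: implement_def blinfun.add_left)
qed

lemma implement_scaleC:
  assumes t: "t \<in> topspace \<tau>"
  shows "implement t (c *\<^sub>C x) = c *\<^sub>C implement t x"
proof -
  have "(\<lambda>s. scaleC_op c (bump_rank_one t x e s)) = bump_rank_one t (c *\<^sub>C x) e"
    by (simp add: bump_rank_one_def scaleC_op_rank_one scaleC.scaleR_right)
  then show ?thesis
    using D_scaleC[OF bump_rank_one_C0, of c t x e t]
    by (simp add: implement_def scaleC_op.rep_eq)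
qed

lemma D_implement:
  assumes X: "X \<in> C0_compact_operators \<tau>" and t: "t \<in> topspace \<tau>"
  shows "D X t x = implement t (X t x) - X t (implement t x)"
proof -
  let ?W = "bump_rank_one t x e"
  \<comment> \<open>A product with an operator of rank one is again of rank one with the same second
    vector \<open>e\<close>, so \<open>D\<close> of it is also expressed by
    \<open>implement\<close>.\<close>
  have eq: "X s o\<^sub>L ?W s = rank_one (bump t s *\<^sub>R X s x) e" for s
    by (simp add: bump_rank_one_def compose_rank_one C0_compact_operators_bounded_operators[OF X]
        blinfun.scaleR_right)
  have X': "X \<in> C0 \<tau>" using X by (simp add: C0_compact_operators_iff)
  have v: "(\<lambda>s. bump t s *\<^sub>R X s x) \<in> C0 \<tau>"
  proof (rule C0_dominated[OF _ X', where C = "norm x"])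
    show "continuous_map \<tau> euclidean (\<lambda>s. bump t s *\<^sub>R X s x)"
      using C0_continuous[OF X'] C0_continuous[OF bump_C0[of t]]
      by (auto simp: continuous_map_euclidean_atin intro!: tendsto_intros)
    fix s
    have "norm (bump t s *\<^sub>R X s x) \<le> norm (X s x)"
      using bump_nonneg[of t s] bump_le_1[of t s] by (simp add: mult_left_le_one_le)
    also have "\<dots> \<le> norm x * norm (X s)" by (metis norm_blinfun mult.commute)
    finally show "norm (bump t s *\<^sub>R X s x) \<le> norm x * norm (X s)" .
  qed
  have "D (\<lambda>s. X s o\<^sub>L ?W s) t e = implement t (X t x)"
    unfolding eq
    by (rule D_eq_implement[OF rank_one_C0_compact_operators[OF v] t]) (simp add: bump_self t)
  moreover have "D (\<lambda>s. X s o\<^sub>L ?W s) t e = D X t (?W t e) + X t (implement t x)"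
    by (simp add: D_compose[OF X bump_rank_one_C0] blinfun.add_left implement_def)
  moreover have "?W t e = x"
    by (simp add: bump_rank_one_eq bump_self t rank_one_apply cinner_e)
  ultimately show ?thesis by (simp add: algebra_simps)
qed

text \<open>The commutator formula for e (x) y at x reads D(e (x) y) x = <x, y> Z e - <Z x, y> e;
  pair it with e. For fixed t and y the right-hand side is visibly bounded in x, although no bound
  on \<open>implement t\<close> is known yet. The same identity later yields the adjoint.\<close>

lemma cinner_implement:
  assumes t: "t \<in> topspace \<tau>"
  shows "cinner (implement t x) y =
    cinner x y * cinner (implement t e) e - cinner (D (bump_rank_one t e y) t x) e"
proof -
  \<comment> \<open>\<open>cinner e e\<close> acts as 1 on vectors even in the trivial space, where
    it is the number 0.\<close>
  have "cinner (implement t x) y * cinner e e = cinner (cinner e e *\<^sub>C implement t x) y"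
    by (simp add: cinner_scaleC_left)
  then have "cinner (implement t x) y * cinner e e = cinner (implement t x) y"
    by (simp only: cinner_e)
  then show ?thesis
    using D_implement[OF bump_rank_one_C0 t, of t e y x]
    by (simp add: bump_rank_one_eq bump_self t rank_one_apply implement_scaleC cinner.diff_left
        cinner_scaleC_left)
qed

text \<open>The element on the right depends on t alone, so its norm continuity passes to
  \<open>implement s x\<close> as s varies over the plateau.\<close>

lemma implement_eq_near:
  assumes "s \<in> topspace \<tau>" "bump t s = 1"
  shows "implement s x = D (bump_rank_one t x e) s e"
  using D_eq_implement[OF bump_rank_one_C0 assms(1), of t x e x] assms(2)
  by (simp add: bump_rank_one_eq)

text \<open>Uniform boundedness for the functionals v |-> <Z(t) v(t), y> indexed by t and y in the
  unit ball. They are pointwise bounded because, for a fixed field v, the vectors Z(t) v(t) are the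
  values at e of the single element D(v (x) e) of the algebra. Fields rather than fixed vectors are
  needed since constant fields need not vanish at infinity.\<close>

lemma implement_bounded_exists:
  "\<exists>M. \<forall>t\<in>topspace \<tau>. \<forall>x. norm x \<le> 1 \<longrightarrow> norm (implement t x) \<le> M"
proof -
  define I where "I = {(t, y). t \<in> topspace \<tau> \<and> norm (y :: 'h) \<le> 1}"
  define \<phi> where "\<phi> = (\<lambda>(t, y) v. cinner (implement t (v t)) y)"
  have lift: "implement t (v t) = D (\<lambda>s. rank_one (v s) e) t e" if "v \<in> C0 \<tau>" "t \<in> topspace \<tau>" for v t
    by (rule D_eq_implement[symmetric, OF rank_one_C0_compact_operators[OF that(1)] that(2)]) simp
  have "\<exists>M. \<forall>i\<in>I. \<forall>v\<in>C0 \<tau>. (\<forall>t. norm (v t) \<le> 1) \<longrightarrow> norm (\<phi> i v) \<le> M"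
  proof (rule C0_uniform_boundedness)
    fix i and v w :: "'l \<Rightarrow> 'h" and r assume i: "i \<in> I"
    then show "\<phi> i (\<lambda>t. v t + w t) = \<phi> i v + \<phi> i w"
      by (auto simp: \<phi>_def I_def implement_add cinner_add_left)
    show "\<phi> i (\<lambda>t. r *\<^sub>R v t) = r *\<^sub>R \<phi> i v"
      using i by (auto simp: \<phi>_def I_def scaleR_scaleC[where 'a='h] implement_scaleC
          cinner_scaleC_left scaleR_conv_of_real)
  next
    fix i assume "i \<in> I"
    then obtain t y where i: "i = (t, y)" "t \<in> topspace \<tau>" "norm y \<le> 1" by (auto simp: I_def)
    let ?M = "norm (implement t e) + norm (D (bump_rank_one t e y) t)"
    have "norm (\<phi> i v) \<le> ?M" if "\<forall>t. norm (v t) \<le> 1" for v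
    proof -
      let ?x = "v t"
      have x: "norm ?x \<le> 1" using that by simp
      have "norm (cinner ?x y) * norm (cinner (implement t e) e) \<le>
          (norm ?x * norm y) * (norm (implement t e) * norm e)"
        by (intro mult_mono norm_cinner_le mult_nonneg_nonneg) auto
      also have "\<dots> \<le> 1 * (norm (implement t e) * 1)"
        using x i norm_e by (intro mult_mono mult_le_one mult_nonneg_nonneg) auto
      finally have 1: "norm (cinner ?x y) * norm (cinner (implement t e) e) \<le> norm (implement t e)"
        by simp
      have "norm (cinner (D (bump_rank_one t e y) t ?x) e) \<le> norm (D (bump_rank_one t e y) t ?x) * norm e"
        by (rule norm_cinner_le)
      also have "\<dots> \<le> (norm (D (bump_rank_one t e y) t) * norm ?x) * norm e"
        by (intro mult_right_mono norm_blinfun) auto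
      also have "\<dots> \<le> norm (D (bump_rank_one t e y) t) * 1 * 1"
        using x norm_e by (intro mult_mono) auto
      finally show ?thesis
        using 1 norm_triangle_ineq4[of "cinner ?x y * cinner (implement t e) e"
            "cinner (D (bump_rank_one t e y) t ?x) e"]
        by (simp add: \<phi>_def i cinner_implement[of t ?x y] norm_mult)
    qed
    then show "\<exists>M. \<forall>v\<in>C0 \<tau>. (\<forall>t. norm (v t) \<le> 1) \<longrightarrow> norm (\<phi> i v) \<le> M" by blast
  next
    fix v :: "'l \<Rightarrow> 'h" assume v: "v \<in> C0 \<tau>"
    have "D (\<lambda>s. rank_one (v s) e) \<in> C0 \<tau>"
      using D_closed[OF rank_one_C0_compact_operators[OF v]] by (simp add: C0_compact_operators_iff)
    then obtain B where B: "\<And>t. norm (D (\<lambda>s. rank_one (v s) e) t) \<le> B"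
      using C0_bounded by blast
    have "norm (\<phi> i v) \<le> B" if "i \<in> I" for i
    proof -
      obtain t y where i: "i = (t, y)" "t \<in> topspace \<tau>" "norm y \<le> 1" using \<open>i \<in> I\<close> by (auto simp: I_def)
      let ?T = "D (\<lambda>s. rank_one (v s) e) t"
      have "norm (\<phi> i v) \<le> norm (?T e) * norm y"
        using norm_cinner_le by (simp add: \<phi>_def i lift[OF v i(2)])
      also have "\<dots> \<le> norm ?T * norm e * norm y"
        by (intro mult_right_mono norm_blinfun) auto
      also have "\<dots> \<le> B * 1 * 1"
        using i norm_e B[of t] order.trans[OF norm_ge_zero B] by (intro mult_mono) auto
      finally show ?thesis by simp
    qed
    then show "\<exists>M. \<forall>i\<in>I. norm (\<phi> i v) \<le> M" by blast
  qed
  then obtain M where M: "\<And>i v. i \<in> I \<Longrightarrow> v \<in> C0 \<tau> \<Longrightarrow> (\<And>t. norm (v t) \<le> 1) \<Longrightarrow> norm (\<phi> i v) \<le> M"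
    by blast
  have "norm (implement t x) \<le> \<bar>M\<bar>" if t: "t \<in> topspace \<tau>" and x: "norm x \<le> 1" for t x
  proof (cases "implement t x = 0")
    case False
    let ?z = "implement t x"
    \<comment> \<open>Pairing with the normalised image turns the bound on functionals into a bound
      on the norm of the image.\<close>
    let ?y = "inverse (norm ?z) *\<^sub>R ?z"
    have "norm (bump t s *\<^sub>R x) \<le> 1" for s
      using bump_nonneg[of t s] bump_le_1[of t s] x by (simp add: mult_le_one)
    then have "norm (\<phi> (t, ?y) (\<lambda>s. bump t s *\<^sub>R x)) \<le> M"
      by (intro M bump_scaleR_C0) (simp_all add: I_def t False)
    moreover have "\<phi> (t, ?y) (\<lambda>s. bump t s *\<^sub>R x) = of_real (norm ?z)"
      using False by (simp add: \<phi>_def bump_self t cinner_scaleR_right cinner_self scaleR_conv_of_real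
          power2_eq_square)
    ultimately show ?thesis by simp
  qed simp
  then show ?thesis by blast
qed

end

section \<open>The strong* topology\<close>

lemma positive_operator_iff:
  "positive_operator T \<longleftrightarrow>
    T \<in> bounded_operators \<and> (\<forall>x. 0 \<le> Re (cinner (T x) x) \<and> Im (cinner (T x) x) = 0)"
  by (auto simp: positive_operator_def complex_nonneg_Reals_iff)

lemma positive_operatorI:
  assumes "T \<in> bounded_operators" "\<And>x. cinner (blinfun_apply T x) x = complex_of_real (r x)" "\<And>x. 0 \<le> r x"
  shows "positive_operator T"
  using assms by (simp add: positive_operator_iff)

lemma positive_operator_0: "positive_operator 0"
  by (simp add: positive_operator_iff bounded_operators_0 cinner.zero_left)

lemma positive_normal_functional_SUP:
  assumes "positive_normal_functional \<phi>" and "A \<noteq> {}" and "\<And>a. a \<in> A \<Longrightarrow> positive_operator a"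
    and "\<And>a b. a \<in> A \<Longrightarrow> b \<in> A \<Longrightarrow> \<exists>c\<in>A. operator_le a c \<and> operator_le b c"
    and "operator_lub A s"
  shows "Re (\<phi> s) = (SUP a\<in>A. Re (\<phi> a))"
  using assms unfolding positive_normal_functional_def by simp

text \<open>The pair \<open>{S, T}\<close> is directed with least upper bound \<open>T\<close>, so normality contains monotonicity.\<close>

lemma positive_normal_functional_mono:
  assumes \<phi>: "positive_normal_functional \<phi>" and S: "positive_operator S" and le: "operator_le S T"
  shows "Re (\<phi> S) \<le> Re (\<phi> T)"
proof -
  have TS: "positive_operator (T - S)" using le by (simp add: operator_le_def)
  then have T_bounded: "T \<in> bounded_operators"
    using S bounded_operators_add[of "T - S" S] by (simp add: positive_operator_iff)
  have "0 \<le> Re (cinner (T x) x) \<and> Im (cinner (T x) x) = 0" for x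
  proof -
    have "cinner (T x) x = cinner ((T - S) x) x + cinner (S x) x"
      by (simp add: blinfun.diff_left cinner.diff_left)
    then show ?thesis using S TS by (simp add: positive_operator_iff)
  qed
  then have T: "positive_operator T" using T_bounded by (simp add: positive_operator_iff)
  have TT: "operator_le T T" by (simp add: operator_le_def positive_operator_0)
  then have "operator_lub {S, T} T"
    using T_bounded le by (simp add: operator_lub_def)
  moreover have "\<exists>c\<in>{S, T}. operator_le a c \<and> operator_le b c" if "a \<in> {S, T}" "b \<in> {S, T}" for a b
    using that le TT by blast
  ultimately have "Re (\<phi> T) = (SUP a\<in>{S, T}. Re (\<phi> a))"
    using S T by (intro positive_normal_functional_SUP[OF \<phi>]) auto
  moreover have "Re (\<phi> S) \<le> (SUP a\<in>{S, T}. Re (\<phi> a))"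
    by (rule cSUP_upper) auto
  ultimately show ?thesis by simp
qed

section \<open>Finite-rank projections and normality\<close>

text \<open>Orthogonal projections of finite rank, built one orthonormal vector at a time;
  \<open>P u = 0\<close> says that \<open>u\<close> is orthogonal to the range. This form gives
  induction without bases or dimensions.\<close>

inductive finite_projection :: "('h::complex_hilbert_space \<Rightarrow>\<^sub>L 'h) \<Rightarrow> bool" where
  zero: "finite_projection 0"
| add: "finite_projection P \<Longrightarrow> P u = 0 \<Longrightarrow> norm u = 1 \<Longrightarrow> finite_projection (P + rank_one u u)"

lemma finite_projection_bounded_operators: "finite_projection P \<Longrightarrow> P \<in> bounded_operators"
  by (induction rule: finite_projection.induct)
    (auto intro: bounded_operators_0 bounded_operators_add rank_one_bounded_operators)

lemma finite_projection_selfadjoint: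
  "finite_projection P \<Longrightarrow> cinner (blinfun_apply P x) y = cinner x (P y)"
  by (induction rule: finite_projection.induct)
    (auto simp: blinfun.add_left cinner_add_left cinner_add_right rank_one_apply cinner_scaleC_left
      cinner_scaleC_right cinner.zero_left cinner.zero_right cinner_commute[symmetric])

lemma finite_projection_idempotent: "finite_projection P \<Longrightarrow> P (P x) = blinfun_apply P x"
proof (induction rule: finite_projection.induct)
  case (add P u)
  have "cinner (P x) u = 0"
    using finite_projection_selfadjoint[OF add.hyps(1), of x u] add.hyps(2) by (simp add: cinner.zero_right)
  moreover have "P (c *\<^sub>C u) = 0" for c
    using bounded_operatorsD[OF finite_projection_bounded_operators[OF add.hyps(1)], of c u] add.hyps(2)
    by (simp add: scaleC.zero_right)
  ultimately show ?case
    using add by (simp add: blinfun.add_left blinfun.add_right rank_one_apply cinner_add_left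
        cinner_scaleC_left cinner_self scaleC.zero_left)
qed simp

lemma cinner_finite_projection:
  assumes P: "finite_projection P"
  shows "cinner (blinfun_apply P x) x = complex_of_real ((norm (P x))\<^sup>2)"
  using finite_projection_selfadjoint[OF P, of "P x" x] finite_projection_idempotent[OF P, of x]
  by (simp add: cinner_self)

lemma finite_projection_positive: "finite_projection P \<Longrightarrow> positive_operator P"
  by (rule positive_operatorI[OF finite_projection_bounded_operators cinner_finite_projection]) simp_all

lemma cinner_finite_projection_complement:
  assumes P: "finite_projection P"
  shows "cinner (x - blinfun_apply P x) x = complex_of_real ((norm (x - P x))\<^sup>2)"
proof -
  have "cinner (x - P x) (P x) = 0"
    using finite_projection_selfadjoint[OF P, of "x - P x" x] finite_projection_idempotent[OF P, of x]
    by (simp add: blinfun.diff_right cinner.zero_left)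
  then show ?thesis
    by (simp add: cinner_self[symmetric] cinner.diff_right del: of_real_power)
qed

text \<open>The hypothesis puts the range of P inside that of R. Then <P x, R x> is the squared norm
  of P x, so Cauchy-Schwarz gives norm (P x) \<le> norm (R x).\<close>

lemma finite_projection_le:
  assumes P: "finite_projection P" and R: "finite_projection R" and RP: "\<And>x. R (P x) = blinfun_apply P x"
  shows "operator_le P R"
  unfolding operator_le_def
proof (rule positive_operatorI[where r = "\<lambda>x. (norm (R x))\<^sup>2 - (norm (P x))\<^sup>2"])
  show "R - P \<in> bounded_operators"
    using P R by (intro bounded_operators_diff finite_projection_bounded_operators)
  fix x
  show "cinner ((R - P) x) x = complex_of_real ((norm (R x))\<^sup>2 - (norm (P x))\<^sup>2)"
    by (simp add: blinfun.diff_left cinner.diff_left cinner_finite_projection[OF P]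
        cinner_finite_projection[OF R])
  have "cinner (P x) (R x) = complex_of_real ((norm (P x))\<^sup>2)"
    using finite_projection_selfadjoint[OF R, of "P x" x] cinner_finite_projection[OF P, of x]
    by (simp add: RP)
  then have "norm (P x) * norm (P x) \<le> norm (P x) * norm (R x)"
    using Re_cinner_le[of "P x" "R x"] by (simp add: power2_eq_square)
  then have "norm (P x) \<le> norm (R x)"
    by (cases "P x = 0") auto
  then show "0 \<le> (norm (R x))\<^sup>2 - (norm (P x))\<^sup>2" by (simp add: power_mono)
qed

text \<open>One Gram-Schmidt step: adjoin the normalised component of u orthogonal to the range of
  P, unless it is zero.\<close>

lemma finite_projection_extend:
  assumes P: "finite_projection P"
  shows "\<exists>R. finite_projection R \<and> (\<forall>y. P y = y \<longrightarrow> R y = y) \<and> blinfun_apply R u = u"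
proof (cases "P u = u")
  case False
  define n where "n = norm (u - P u)"
  define w where "w = inverse n *\<^sub>R (u - P u)"
  have n: "0 < n" using False by (simp add: n_def)
  have Pw: "P w = 0"
    by (simp add: w_def blinfun.scaleR_right blinfun.diff_right finite_projection_idempotent[OF P])
  have orth: "cinner (P y) w = 0" for y
    by (simp add: finite_projection_selfadjoint[OF P] Pw cinner.zero_right)
  have "finite_projection (P + rank_one w w)"
    using n by (intro finite_projection.add P Pw) (simp add: w_def n_def)
  moreover have "(P + rank_one w w) y = y" if "P y = y" for y
    using orth[of y] that by (simp add: blinfun.add_left rank_one_apply scaleC.zero_left)
  moreover have "(P + rank_one w w) u = u"
  proof -
    have "cinner u w = cinner (u - P u) w" by (simp add: cinner.diff_left orth)
    also have "\<dots> = complex_of_real n"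
      using n by (simp add: w_def cinner_scaleR_right cinner_self scaleR_conv_of_real
          power2_eq_square flip: n_def)
    finally have "cinner u w *\<^sub>C w = u - P u"
      using n by (simp add: w_def flip: scaleR_scaleC)
    then show ?thesis by (simp add: blinfun.add_left rank_one_apply)
  qed
  ultimately show ?thesis by blast
qed (use P in blast)

text \<open>Starting from P, the vectors that build Q are adjoined one after another by
  Gram-Schmidt; the induction is on Q.\<close>

lemma finite_projection_directed:
  assumes P: "finite_projection P" and Q: "finite_projection Q"
  shows "\<exists>R. finite_projection R \<and> operator_le P R \<and> operator_le Q R"
proof -
  from Q have "\<exists>R. finite_projection R \<and> (\<forall>y. P y = y \<longrightarrow> R y = y) \<and> (\<forall>x. R (Q x) = Q x)"
  proof (induction rule: finite_projection.induct)
    case zero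
    then show ?case using P by auto
  next
    case (add Q u)
    then obtain R where R: "finite_projection R" "\<forall>y. P y = y \<longrightarrow> R y = y" "\<forall>x. R (Q x) = Q x"
      by blast
    obtain S where S: "finite_projection S" "\<forall>y. R y = y \<longrightarrow> S y = y" "S u = u"
      using finite_projection_extend[OF R(1)] by blast
    have "S (Q x + c *\<^sub>C u) = Q x + c *\<^sub>C u" for x c
      using S R bounded_operatorsD[OF finite_projection_bounded_operators[OF S(1)], of c u]
      by (simp add: blinfun.add_right)
    then show ?case
      using S R by (intro exI[of _ S]) (simp add: blinfun.add_left rank_one_apply)
  qed
  then obtain R where R: "finite_projection R" "\<forall>y. P y = y \<longrightarrow> R y = y" "\<forall>x. R (Q x) = Q x"
    by blast
  then show ?thesis
    using finite_projection_le[OF P R(1)] finite_projection_le[OF Q R(1)]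
      finite_projection_idempotent[OF P] by blast
qed

lemma finite_projection_lub:
  "operator_lub {P :: 'h::complex_hilbert_space \<Rightarrow>\<^sub>L 'h. finite_projection P} id_blinfun"
  unfolding operator_lub_def
proof (intro conjI ballI impI)
  show "id_blinfun \<in> bounded_operators" by (rule bounded_operators_id)
  fix P :: "'h \<Rightarrow>\<^sub>L 'h" assume "P \<in> {P. finite_projection P}"
  then have P: "finite_projection P" by simp
  show "operator_le P id_blinfun"
    unfolding operator_le_def
    by (rule positive_operatorI[where r = "\<lambda>x. (norm (x - P x))\<^sup>2", OF
          bounded_operators_diff[OF bounded_operators_id finite_projection_bounded_operators[OF P]]])
      (simp_all add: blinfun.diff_left cinner_finite_projection_complement[OF P] del: of_real_power)
next
  fix T :: "'h \<Rightarrow>\<^sub>L 'h"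
  assume T: "T \<in> bounded_operators" and upper: "\<forall>P\<in>{P. finite_projection P}. operator_le P T"
  have "0 \<le> Re (cinner ((T - id_blinfun) x) x) \<and> Im (cinner ((T - id_blinfun) x) x) = 0" for x
  proof -
    \<comment> \<open>To test positivity of \<open>T - id_blinfun\<close> at one vector, a
      projection fixing that vector is enough.\<close>
    obtain P where P: "finite_projection P" "P x = x"
      using finite_projection_extend[OF finite_projection.zero] by blast
    have "positive_operator (T - P)" using upper P(1) by (simp add: operator_le_def)
    then have "0 \<le> Re (cinner ((T - P) x) x) \<and> Im (cinner ((T - P) x) x) = 0"
      by (simp add: positive_operator_iff)
    then show ?thesis by (simp add: blinfun.diff_left P(2))
  qed
  then show "operator_le id_blinfun T"
    using T by (simp add: operator_le_def positive_operator_iff bounded_operators_diff bounded_operators_id)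
qed

text \<open>Here normality is decisive: a state vanishing on the compact operators is zero on every
  such P.\<close>

lemma positive_normal_functional_approx:
  assumes \<phi>: "positive_normal_functional \<phi>" and "0 < \<delta>"
  shows "\<exists>P. finite_projection P \<and> Re (\<phi> id_blinfun) - \<delta> < Re (\<phi> P)"
proof (rule ccontr)
  assume "\<not> ?thesis"
  then have le: "\<And>P. finite_projection P \<Longrightarrow> Re (\<phi> P) \<le> Re (\<phi> id_blinfun) - \<delta>"
    by (auto simp: not_less)
  let ?A = "{P. finite_projection P}"
  have "?A \<noteq> {}" using finite_projection.zero by blast
  then have "Re (\<phi> id_blinfun) = (SUP a\<in>?A. Re (\<phi> a))"
  proof (rule positive_normal_functional_SUP[OF \<phi>])
    show "\<exists>c\<in>?A. operator_le a c \<and> operator_le b c" if "a \<in> ?A" "b \<in> ?A" for a b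
      using finite_projection_directed[of a b] that by auto
  qed (simp_all add: finite_projection_positive finite_projection_lub)
  also have "\<dots> \<le> Re (\<phi> id_blinfun) - \<delta>"
    using \<open>?A \<noteq> {}\<close> le by (intro cSUP_least) auto
  finally show False using \<open>0 < \<delta>\<close> by simp
qed

text \<open>Composed with a finite-rank projection, pointwise convergence becomes norm convergence,
  since only finitely many vectors are involved.\<close>

lemma finite_projection_compose_tendsto:
  assumes P: "finite_projection P" and R: "\<And>t. R t \<in> bounded_operators"
    and lim: "\<And>x. ((\<lambda>t. blinfun_apply (R t) x) \<longlongrightarrow> 0) F"
  shows "((\<lambda>t. R t o\<^sub>L P) \<longlongrightarrow> 0) F"
  using P
proof (induction rule: finite_projection.induct)
  case (add P u)
  have "((\<lambda>t. (R t o\<^sub>L P) + rank_one (R t u) u) \<longlongrightarrow> 0 + rank_one 0 u) F"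
    by (intro tendsto_add add.IH rank_one.tendsto lim tendsto_const)
  then show ?case
    by (simp add: compose_rank_one R rank_one.zero_left
        bounded_bilinear.add_right[OF bounded_bilinear_blinfun_compose])
qed (simp add: bounded_bilinear.zero_right[OF bounded_bilinear_blinfun_compose])

section \<open>Semicontinuity of normal functionals\<close>

lemma norm_add_squared_le:
  assumes "0 < \<eta>"
  shows "(norm (x + y))\<^sup>2 \<le> (1 + 1 / \<eta>) * (norm x)\<^sup>2 + (1 + \<eta>) * (norm (y :: 'a::real_normed_vector))\<^sup>2"
proof -
  have "(norm (x + y))\<^sup>2 \<le> (norm x + norm y)\<^sup>2"
    by (intro power_mono norm_triangle_ineq) simp
  \<comment> \<open>An identity with an explicit square as remainder. The weight
    \<open>\<eta>\<close> lets the coefficient of the second term come as close to 1 as desired, so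
    the limit operator loses almost nothing.\<close>
  also have "\<dots> = (1 + 1 / \<eta>) * (norm x)\<^sup>2 + (1 + \<eta>) * (norm y)\<^sup>2 - (norm x - \<eta> * norm y)\<^sup>2 / \<eta>"
    using assms by (simp add: field_simps power2_eq_square)
  also have "\<dots> \<le> (1 + 1 / \<eta>) * (norm x)\<^sup>2 + (1 + \<eta>) * (norm y)\<^sup>2"
    using assms by simp
  finally show ?thesis .
qed

lemma cinner_adjoint_compose:
  assumes T: "T \<in> bounded_operators"
  shows "cinner ((hilbert_adjoint T o\<^sub>L T) x) x = complex_of_real ((norm (blinfun_apply T x))\<^sup>2)"
  by (simp add: cinner_hilbert_adjoint_left[OF T] cinner_self)

lemma adjoint_compose_bounded_operators:
  "T \<in> bounded_operators \<Longrightarrow> hilbert_adjoint T o\<^sub>L T \<in> bounded_operators"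
  by (intro bounded_operators_compose hilbert_adjoint_bounded_operators)

text \<open>Splitting \<open>R + B = R P + R (1 - P) + B\<close> bounds \<open>(R + B)\<^sup>* (R + B)\<close> by a combination of
  \<open>B\<^sup>* B\<close>, \<open>1\<close> and \<open>1 - P\<close>.\<close>

lemma positive_normal_functional_le:
  assumes \<phi>: "positive_normal_functional \<phi>" and P: "finite_projection P"
    and R: "R \<in> bounded_operators" and B: "B \<in> bounded_operators"
    and \<eta>: "0 < \<eta>" and M: "norm R \<le> M"
  shows "Re (\<phi> (hilbert_adjoint (R + B) o\<^sub>L (R + B))) \<le>
    (1 + \<eta>) * Re (\<phi> (hilbert_adjoint B o\<^sub>L B)) +
    (1 + 1 / \<eta>) * (2 * (norm (R o\<^sub>L P))\<^sup>2 * Re (\<phi> id_blinfun) +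
      2 * M\<^sup>2 * (Re (\<phi> id_blinfun) - Re (\<phi> P)))"
proof -
  let ?T = "R + B" and ?n = "norm (R o\<^sub>L P)"
  define a where "a = 1 + \<eta>"
  \<comment> \<open>\<open>b\<close> and \<open>c\<close> are arranged so that
    \<open>b * 1 - c * P\<close> equals (1 + 1/\<eta>) times the sum of \<open>2 * ?n^2 * 1\<close>
    and \<open>2 * M^2 * (1 - P)\<close>: the first part bounds \<open>R P\<close>, the second
    \<open>R (1 - P)\<close>.\<close>
  define b where "b = (1 + 1 / \<eta>) * (2 * ?n\<^sup>2 + 2 * M\<^sup>2)"
  define c where "c = (1 + 1 / \<eta>) * (2 * M\<^sup>2)"
  define G where "G = scaleC_op (of_real a) (hilbert_adjoint B o\<^sub>L B) +
    (scaleC_op (of_real b) id_blinfun + scaleC_op (of_real (- c)) P)"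
  have T: "?T \<in> bounded_operators" using R B by (rule bounded_operators_add)
  note closed = bounded_operators_add bounded_operators_scaleC_op bounded_operators_id
    adjoint_compose_bounded_operators[OF B] adjoint_compose_bounded_operators[OF T]
    finite_projection_bounded_operators[OF P]
  have G: "G \<in> bounded_operators"
    unfolding G_def by (intro closed)
  have cinner_G: "cinner (G x) x = complex_of_real (a * (norm (B x))\<^sup>2 + b * (norm x)\<^sup>2 - c * (norm (P x))\<^sup>2)" for x
    using cinner_adjoint_compose[OF B, of x] cinner_finite_projection[OF P, of x] cinner_self[of x]
    by (simp add: G_def blinfun.add_left scaleC_op.rep_eq cinner_add_left cinner_scaleC_left
        del: blinfun_apply_blinfun_compose)
  have norm_le: "(norm (?T x))\<^sup>2 \<le> a * (norm (B x))\<^sup>2 + b * (norm x)\<^sup>2 - c * (norm (P x))\<^sup>2" for x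
  proof -
    have pythagoras: "(norm (x - P x))\<^sup>2 = (norm x)\<^sup>2 - (norm (P x))\<^sup>2"
    proof -
      have "complex_of_real ((norm (x - P x))\<^sup>2) = complex_of_real ((norm x)\<^sup>2 - (norm (P x))\<^sup>2)"
        by (simp only: cinner_finite_projection_complement[OF P, symmetric] cinner.diff_left
            cinner_finite_projection[OF P] of_real_diff cinner_self)
      then show ?thesis by (simp only: of_real_eq_iff)
    qed
    have "(norm (R x))\<^sup>2 = (norm ((R o\<^sub>L P) x + R (x - P x)))\<^sup>2" by (simp add: blinfun.diff_right)
    also have "\<dots> \<le> 2 * (norm ((R o\<^sub>L P) x))\<^sup>2 + 2 * (norm (R (x - P x)))\<^sup>2"
      using norm_add_squared_le[of 1 "(R o\<^sub>L P) x" "R (x - P x)"] by simp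
    also have "\<dots> \<le> 2 * (?n * norm x)\<^sup>2 + 2 * (M * norm (x - P x))\<^sup>2"
      using norm_blinfun[of R "x - P x"] mult_right_mono[OF M norm_ge_zero[of "x - P x"]]
      by (intro add_mono mult_left_mono power_mono norm_blinfun) auto
    also have "\<dots> = (2 * ?n\<^sup>2 + 2 * M\<^sup>2) * (norm x)\<^sup>2 - 2 * M\<^sup>2 * (norm (P x))\<^sup>2"
      by (simp add: power_mult_distrib pythagoras algebra_simps)
    finally have "(1 + 1 / \<eta>) * (norm (R x))\<^sup>2 \<le>
        (1 + 1 / \<eta>) * ((2 * ?n\<^sup>2 + 2 * M\<^sup>2) * (norm x)\<^sup>2 - 2 * M\<^sup>2 * (norm (P x))\<^sup>2)"
      using \<eta> by (intro mult_left_mono) auto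
    also have "\<dots> = b * (norm x)\<^sup>2 - c * (norm (P x))\<^sup>2" by (simp add: b_def c_def right_diff_distrib)
    finally show ?thesis
      using norm_add_squared_le[OF \<eta>, of "R x" "B x"] by (simp add: blinfun.add_left a_def)
  qed
  have "positive_operator (hilbert_adjoint ?T o\<^sub>L ?T)"
    by (rule positive_operatorI[OF adjoint_compose_bounded_operators[OF T] cinner_adjoint_compose[OF T]]) simp
  moreover have "operator_le (hilbert_adjoint ?T o\<^sub>L ?T) G"
    unfolding operator_le_def
  proof (rule positive_operatorI)
    show "G - (hilbert_adjoint ?T o\<^sub>L ?T) \<in> bounded_operators"
      by (intro bounded_operators_diff G closed)
    show "cinner ((G - (hilbert_adjoint ?T o\<^sub>L ?T)) x) x = complex_of_real
        (a * (norm (B x))\<^sup>2 + b * (norm x)\<^sup>2 - c * (norm (P x))\<^sup>2 - (norm (?T x))\<^sup>2)" for x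
      by (simp only: blinfun.diff_left cinner.diff_left cinner_G cinner_adjoint_compose[OF T] of_real_diff)
  qed (use norm_le in simp)
  ultimately have "Re (\<phi> (hilbert_adjoint ?T o\<^sub>L ?T)) \<le> Re (\<phi> G)"
    by (rule positive_normal_functional_mono[OF \<phi>])
  also have "\<phi> G = of_real a * \<phi> (hilbert_adjoint B o\<^sub>L B) +
      (of_real b * \<phi> id_blinfun + of_real (- c) * \<phi> P)"
  proof -
    have add: "\<phi> (S + T) = \<phi> S + \<phi> T" if "S \<in> bounded_operators" "T \<in> bounded_operators" for S T
      using \<phi> that by (simp add: positive_normal_functional_def positive_functional_def)
    have scale: "\<phi> (scaleC_op k T) = k * \<phi> T" if "T \<in> bounded_operators" for k T
      using \<phi> that by (simp add: positive_normal_functional_def positive_functional_def)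
    show ?thesis unfolding G_def by (simp only: add scale closed)
  qed
  finally show ?thesis
    by (simp add: a_def b_def c_def algebra_simps)
qed

text \<open>Upper semicontinuity along bounded, pointwise convergent families. The one-sided form
  suffices because the generating sets of the topology are strict upper bounds on seminorms. The
  constants are chosen in the order \<eta>, \<delta>, P; only then does t move.\<close>

lemma positive_normal_functional_eventually_less:
  assumes \<phi>: "positive_normal_functional \<phi>"
    and T: "\<And>t. T t \<in> bounded_operators" and B: "B \<in> bounded_operators"
    and M: "\<And>t. norm (T t) \<le> M"
    and lim: "\<And>x. ((\<lambda>t. blinfun_apply (T t) x) \<longlongrightarrow> B x) F"
    and less: "Re (\<phi> (hilbert_adjoint B o\<^sub>L B)) < c"
  shows "\<forall>\<^sub>F t in F. Re (\<phi> (hilbert_adjoint (T t) o\<^sub>L T t)) < c"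
proof -
  define b where "b = Re (\<phi> (hilbert_adjoint B o\<^sub>L B))"
  have b: "0 \<le> b"
    using \<phi> B by (simp add: b_def positive_normal_functional_def positive_functional_def
        complex_nonneg_Reals_iff)
  \<comment> \<open>Gives \<open>(1 + \<eta>) * b \<le> (b + c) / 2 < c\<close>; the
    \<open>b + 1\<close> covers the case \<open>b = 0\<close>.\<close>
  define \<eta> where "\<eta> = (c - b) / 2 / (b + 1)"
  have \<eta>: "0 < \<eta>" using less b by (simp add: \<eta>_def b_def[symmetric])
  have "\<eta> * b \<le> \<eta> * (b + 1)" using \<eta> by simp
  also have "\<dots> = (c - b) / 2" using b unfolding \<eta>_def by (intro nonzero_eq_divide_eq[THEN iffD1, OF _ refl]) simp
  finally have \<eta>b: "(1 + \<eta>) * b < c" using less by (simp add: b_def[symmetric] distrib_right)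
  define N where "N = M + norm B"
  define K where "K = (1 + 1 / \<eta>) * (2 * N\<^sup>2)"
  have K: "0 \<le> K" using \<eta> by (simp add: K_def)
  \<comment> \<open>Half of the budget, the gap left after \<open>\<eta>\<close>, pays for
    \<open>R (1 - P)\<close>; the \<open>K + 1\<close> keeps the quotient meaningful for
    \<open>K = 0\<close> and the final inequality strict.\<close>
  define \<delta> where "\<delta> = (c - (1 + \<eta>) * b) / (K + 1)"
  have \<delta>: "0 < \<delta>" using \<eta>b K by (simp add: \<delta>_def)
  have "K * \<delta> < (K + 1) * \<delta>" using \<delta> by simp
  also have "\<dots> = c - (1 + \<eta>) * b" using K by (simp add: \<delta>_def)
  finally have K\<delta>: "(1 + \<eta>) * b + K * \<delta> < c" by simp
  obtain P where P: "finite_projection P" "Re (\<phi> id_blinfun) - \<delta> < Re (\<phi> P)"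
    using positive_normal_functional_approx[OF \<phi> \<delta>] by blast
  define R where "R t = T t - B" for t
  have R: "R t \<in> bounded_operators" for t using T B by (simp add: R_def bounded_operators_diff)
  have "((\<lambda>t. R t x) \<longlongrightarrow> 0) F" for x
    using tendsto_diff[OF lim[of x] tendsto_const[of "B x"]] by (simp add: R_def blinfun.diff_left)
  then have RP: "((\<lambda>t. R t o\<^sub>L P) \<longlongrightarrow> 0) F"
    by (rule finite_projection_compose_tendsto[OF P(1) R])
  define h where "h t = (1 + \<eta>) * b + (1 + 1 / \<eta>) * (2 * (norm (R t o\<^sub>L P))\<^sup>2 * Re (\<phi> id_blinfun)
    + 2 * N\<^sup>2 * (Re (\<phi> id_blinfun) - Re (\<phi> P)))" for t
  have "(h \<longlongrightarrow> (1 + \<eta>) * b + (1 + 1 / \<eta>) * (2 * (norm (0 :: 'a \<Rightarrow>\<^sub>L 'a))\<^sup>2 * Re (\<phi> id_blinfun)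
    + 2 * N\<^sup>2 * (Re (\<phi> id_blinfun) - Re (\<phi> P)))) F"
    unfolding h_def by (intro tendsto_intros RP)
  then have "(h \<longlongrightarrow> (1 + \<eta>) * b + K * (Re (\<phi> id_blinfun) - Re (\<phi> P))) F"
    by (simp add: K_def mult.assoc)
  moreover have "K * (Re (\<phi> id_blinfun) - Re (\<phi> P)) \<le> K * \<delta>"
    using K P(2) by (intro mult_left_mono) auto
  then have "(1 + \<eta>) * b + K * (Re (\<phi> id_blinfun) - Re (\<phi> P)) < c" using K\<delta> by linarith
  ultimately have "\<forall>\<^sub>F t in F. h t < c"
    by (rule order_tendstoD(2))
  then show ?thesis
  proof eventually_elim
    case (elim t)
    have "norm (R t) \<le> N"
      using norm_triangle_ineq4[of "T t" B] M[of t] by (simp add: R_def N_def)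
    from positive_normal_functional_le[OF \<phi> P(1) R B \<eta> this] elim
    show ?case by (simp add: h_def b_def R_def)
  qed
qed

text \<open>Semicontinuity is applied to \<open>Z s - S\<close> with limit \<open>Z t - S\<close>
  for an arbitrary centre \<open>S\<close>, which avoids proving a triangle inequality for the
  seminorms.\<close>

lemma continuous_map_strong_star_topology:
  fixes Z :: "'l \<Rightarrow> ('h::complex_hilbert_space \<Rightarrow>\<^sub>L 'h)"
  assumes Z: "\<And>t. Z t \<in> bounded_operators" and M: "\<And>t. norm (Z t) \<le> M"
    and cont: "\<And>x. continuous_map \<tau> euclidean (\<lambda>t. blinfun_apply (Z t) x)"
    and cont_adjoint: "\<And>x. continuous_map \<tau> euclidean (\<lambda>t. blinfun_apply (hilbert_adjoint (Z t)) x)"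
  shows "continuous_map \<tau> strong_star_topology Z"
  unfolding strong_star_topology_def
proof (rule continuous_on_generated_topo)
  show "Z ` topspace \<tau> \<subseteq> \<Union> {{T \<in> bounded_operators. p (T - S) < \<epsilon>} | p S \<epsilon>.
      p \<in> strong_star_seminorms \<and> S \<in> bounded_operators \<and> 0 < \<epsilon>}"
    using Z unfolding topspace_strong_star_topology[unfolded strong_star_topology_def
        topology_generated_by_topspace]
    by blast
next
  fix U :: "('h \<Rightarrow>\<^sub>L 'h) set" assume "U \<in> {{T \<in> bounded_operators. p (T - S) < \<epsilon>} | p S \<epsilon>.
      p \<in> strong_star_seminorms \<and> S \<in> bounded_operators \<and> 0 < \<epsilon>}"
  then obtain p S \<epsilon> where U: "U = {T \<in> bounded_operators. p (T - S) < \<epsilon>}"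
    and p: "p \<in> strong_star_seminorms" and S: "S \<in> bounded_operators" and \<epsilon>: "0 < \<epsilon>"
    by blast
  have sqrt_less: "sqrt r < \<epsilon> \<longleftrightarrow> r < \<epsilon>\<^sup>2" for r
    using \<epsilon> real_sqrt_less_iff[of r "\<epsilon>\<^sup>2"] by simp
  have ZS: "Z t - S \<in> bounded_operators" for t using Z S by (rule bounded_operators_diff)
  have norm_ZS: "norm (Z t - S) \<le> M + norm S" for t
    using norm_triangle_ineq4[of "Z t" S] M[of t] by simp
  have near: "\<forall>\<^sub>F s in atin \<tau> t. p (Z s - S) < \<epsilon>"
    if t: "t \<in> topspace \<tau>" and less: "p (Z t - S) < \<epsilon>" for t
  proof -
    have "((\<lambda>s. Z s x) \<longlongrightarrow> Z t x) (atin \<tau> t)" for x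
      using cont[of x] t by (simp add: continuous_map_euclidean_atin)
    then have lim: "((\<lambda>s. (Z s - S) x) \<longlongrightarrow> (Z t - S) x) (atin \<tau> t)" for x
      by (simp add: blinfun.diff_left tendsto_diff)
    have "((\<lambda>s. hilbert_adjoint (Z s) x) \<longlongrightarrow> hilbert_adjoint (Z t) x) (atin \<tau> t)" for x
      using cont_adjoint[of x] t by (simp add: continuous_map_euclidean_atin)
    then have lim_adjoint: "((\<lambda>s. hilbert_adjoint (Z s - S) x) \<longlongrightarrow> hilbert_adjoint (Z t - S) x) (atin \<tau> t)" for x
      by (simp add: hilbert_adjoint_diff Z S blinfun.diff_left tendsto_diff)
    from p consider
      \<phi> where "positive_normal_functional \<phi>" "p = (\<lambda>T. sqrt (Re (\<phi> (hilbert_adjoint T o\<^sub>L T))))"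
      | \<phi> where "positive_normal_functional \<phi>" "p = (\<lambda>T. sqrt (Re (\<phi> (T o\<^sub>L hilbert_adjoint T))))"
      unfolding strong_star_seminorms_def by blast
    then show ?thesis
    proof cases
      case 1
      show ?thesis
        using positive_normal_functional_eventually_less[OF 1(1) ZS ZS norm_ZS lim] less
        by (simp add: 1(2) sqrt_less)
    next
      \<comment> \<open>With A the adjoint of T, the product T A is (adjoint of A) A, so the first
        case applies to the adjoint family.\<close>
      case 2
      have "norm (hilbert_adjoint (Z s - S)) \<le> M + norm S" for s
        using norm_hilbert_adjoint_le[OF ZS] norm_ZS by (rule order.trans)
      from positive_normal_functional_eventually_less[OF 2(1) hilbert_adjoint_bounded_operators[OF ZS]
          hilbert_adjoint_bounded_operators[OF ZS] this lim_adjoint] less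
      show ?thesis
        by (simp add: 2(2) sqrt_less hilbert_adjoint_hilbert_adjoint[OF ZS])
    qed
  qed
  show "openin \<tau> (Z -` U \<inter> topspace \<tau>)"
  proof (subst openin_subopen, intro ballI)
    fix t assume "t \<in> Z -` U \<inter> topspace \<tau>"
    then have t: "t \<in> topspace \<tau>" "p (Z t - S) < \<epsilon>" by (auto simp: U)
    \<comment> \<open>The filter \<open>atin\<close> omits \<open>t\<close> itself; there the
      inequality holds by the choice of \<open>t\<close>.\<close>
    obtain W where W: "openin \<tau> W" "t \<in> W" "\<forall>s\<in>W - {t}. p (Z s - S) < \<epsilon>"
      using near[OF t] t(1) by (auto simp: eventually_atin)
    then have "W \<subseteq> Z -` U \<inter> topspace \<tau>"
      using t(2) openin_subset[OF W(1)] Z by (auto simp: U)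
    with W show "\<exists>W. openin \<tau> W \<and> t \<in> W \<and> W \<subseteq> Z -` U \<inter> topspace \<tau>" by blast
  qed
qed

section \<open>Boundedness and continuity of the implementing multiplier\<close>

text \<open>Convergence in norm is essential: pointwise convergence does not pass to adjoints. It
  will be applied to values of \<open>D X\<close>, which do converge in norm.\<close>

lemma tendsto_hilbert_adjoint:
  assumes "(A \<longlongrightarrow> a) F" and A: "\<And>s. A s \<in> bounded_operators" and a: "a \<in> bounded_operators"
  shows "((\<lambda>s. hilbert_adjoint (A s)) \<longlongrightarrow> hilbert_adjoint a) F"
proof (rule LIM_zero_cancel, rule Lim_null_comparison)
  show "\<forall>\<^sub>F s in F. norm (hilbert_adjoint (A s) - hilbert_adjoint a) \<le> norm (A s - a)"
    using norm_hilbert_adjoint_le[OF bounded_operators_diff[OF A a]]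
    by (simp add: hilbert_adjoint_diff A a)
  show "((\<lambda>s. norm (A s - a)) \<longlongrightarrow> 0) F"
    by (intro tendsto_norm_zero LIM_zero assms(1))
qed

lemma
  assumes "\<And>t. t \<in> topspace \<tau> \<Longrightarrow> norm (F t) \<le> B"
  shows sup_norm_upper: "t \<in> topspace \<tau> \<Longrightarrow> norm (F t) \<le> sup_norm \<tau> F"
    and sup_norm_nonneg: "0 \<le> sup_norm \<tau> F"
proof -
  have "bdd_above (insert 0 ((\<lambda>t. norm (F t)) ` topspace \<tau>))"
    using assms by (intro bdd_above_insert[THEN iffD2] bdd_aboveI2[where M = B]) simp
  then show "t \<in> topspace \<tau> \<Longrightarrow> norm (F t) \<le> sup_norm \<tau> F" and "0 \<le> sup_norm \<tau> F"
    unfolding sup_norm_def by (auto intro: cSup_upper)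
qed

lemma sup_norm_least:
  assumes "\<And>t. t \<in> topspace \<tau> \<Longrightarrow> norm (F t) \<le> c" and "0 \<le> c"
  shows "sup_norm \<tau> F \<le> c"
  unfolding sup_norm_def using assms by (intro cSup_least) auto

lemma C0_compact_operators_outside:
  "X \<in> C0_compact_operators \<tau> \<Longrightarrow> t \<notin> topspace \<tau> \<Longrightarrow> X t = 0"
  by (simp add: C0_compact_operators_def)

lemma C0_compact_operators_norm_le:
  assumes "X \<in> C0_compact_operators \<tau>"
  shows "norm (X t) \<le> sup_norm \<tau> X"
proof -
  obtain B where B: "\<And>t. norm (X t) \<le> B"
    using C0_bounded assms unfolding C0_compact_operators_iff by blast
  show ?thesis
  proof (cases "t \<in> topspace \<tau>")
    case False
    then show ?thesis
      using sup_norm_nonneg[of \<tau> X B] B by (simp add: C0_compact_operators_outside[OF assms])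
  qed (use B in \<open>auto intro: sup_norm_upper\<close>)
qed

context C0_derivation_vector
begin

text \<open>Zero off the space, so that the commutator identity holds between functions on the whole
  type, where elements of the algebra are extended by zero as well.\<close>

definition multiplier :: "'l \<Rightarrow> ('h \<Rightarrow>\<^sub>L 'h)"
  where "multiplier t = (if t \<in> topspace \<tau> then Blinfun (implement t) else 0)"

lemma implement_scaleR:
  "t \<in> topspace \<tau> \<Longrightarrow> implement t (r *\<^sub>R x) = r *\<^sub>R implement t x"
  by (simp add: implement_scaleC scaleR_scaleC[where 'a='h])

lemma implement_norm_le:
  assumes t: "t \<in> topspace \<tau>" and M: "\<And>x. norm x \<le> 1 \<Longrightarrow> norm (implement t x) \<le> M"
  shows "norm (implement t x) \<le> norm x * M"
proof (cases "x = 0")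
  case True
  then show ?thesis using implement_scaleR[OF t, of 0 0] by simp
next
  case False
  then have "norm (implement t (inverse (norm x) *\<^sub>R x)) \<le> M" by (intro M) simp
  then show ?thesis using False by (simp add: implement_scaleR[OF t] field_simps)
qed

lemma bounded_linear_implement:
  assumes t: "t \<in> topspace \<tau>"
  shows "bounded_linear (implement t)"
proof -
  obtain M where M: "\<And>x. norm x \<le> 1 \<Longrightarrow> norm (implement t x) \<le> M"
    using implement_bounded_exists t by blast
  show ?thesis
    by (rule bounded_linear_intro[where K = M])
      (simp_all add: implement_add[OF t] implement_scaleR[OF t] implement_norm_le[OF t M])
qed

lemma multiplier_apply: "t \<in> topspace \<tau> \<Longrightarrow> blinfun_apply (multiplier t) = implement t"
  by (simp add: multiplier_def bounded_linear_Blinfun_apply bounded_linear_implement)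

lemma multiplier_bounded_operators: "multiplier t \<in> bounded_operators"
proof (cases "t \<in> topspace \<tau>")
  case True
  then show ?thesis by (intro bounded_operatorsI) (simp add: multiplier_apply implement_scaleC)
qed (simp add: multiplier_def bounded_operators_0)

lemma norm_multiplier_le:
  assumes M: "\<And>t x. t \<in> topspace \<tau> \<Longrightarrow> norm x \<le> 1 \<Longrightarrow> norm (implement t x) \<le> M" and "0 \<le> M"
  shows "norm (multiplier t) \<le> M"
proof (cases "t \<in> topspace \<tau>")
  case True
  show ?thesis
    by (rule norm_blinfun_bound[OF \<open>0 \<le> M\<close>])
      (use implement_norm_le[OF True M[OF True]] in \<open>simp add: multiplier_apply True mult.commute\<close>)
qed (use \<open>0 \<le> M\<close> in \<open>simp add: multiplier_def\<close>)

lemma D_eq_commutator: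
  assumes X: "X \<in> C0_compact_operators \<tau>"
  shows "D X = pointwise_commutator multiplier X"
proof (rule ext, rule blinfun_eqI)
  fix t x
  show "D X t x = pointwise_commutator multiplier X t x"
  proof (cases "t \<in> topspace \<tau>")
    case True
    then show ?thesis
      by (simp add: D_implement[OF X] pointwise_commutator_def blinfun.diff_left multiplier_apply)
  next
    case False
    then have "X t = 0" "D X t = 0"
      by (simp_all add: C0_compact_operators_outside[OF X] C0_compact_operators_outside[OF D_closed[OF X]])
    then show ?thesis by (simp add: pointwise_commutator_def blinfun.diff_left)
  qed
qed

text \<open>Boundedness of \<open>D\<close>: commutators with the uniformly bounded multiplier are
  bounded on the unit ball, so the supremum in \<open>derivation_norm\<close> is that of a bounded
  set.\<close>

lemma derivation_norm_upper:
  assumes X: "X \<in> C0_compact_operators \<tau>" and "sup_norm \<tau> X \<le> 1"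
  shows "sup_norm \<tau> (D X) \<le> derivation_norm \<tau> D"
proof -
  obtain M where M: "\<And>t x. t \<in> topspace \<tau> \<Longrightarrow> norm x \<le> 1 \<Longrightarrow> norm (implement t x) \<le> M"
    using implement_bounded_exists by blast
  have Z: "norm (multiplier t) \<le> \<bar>M\<bar>" for t
    by (rule norm_multiplier_le) (use M in force)+
  have "sup_norm \<tau> (D Y) \<le> \<bar>M\<bar> + \<bar>M\<bar>" if Y: "Y \<in> C0_compact_operators \<tau>" "sup_norm \<tau> Y \<le> 1" for Y
  proof (rule sup_norm_least)
    fix t
    have Yt: "norm (Y t) \<le> 1" using C0_compact_operators_norm_le[OF Y(1)] Y(2) by (rule order.trans)
    have "norm (D Y t) \<le> norm (multiplier t o\<^sub>L Y t) + norm (Y t o\<^sub>L multiplier t)"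
      by (simp add: D_eq_commutator[OF Y(1)] pointwise_commutator_def norm_triangle_ineq4)
    also have "\<dots> \<le> norm (multiplier t) * norm (Y t) + norm (Y t) * norm (multiplier t)"
      by (intro add_mono norm_blinfun_compose)
    also have "\<dots> \<le> \<bar>M\<bar> * 1 + 1 * \<bar>M\<bar>"
      by (intro add_mono mult_mono Z Yt) auto
    finally show "norm (D Y t) \<le> \<bar>M\<bar> + \<bar>M\<bar>" by simp
  qed simp
  then have "bdd_above ((\<lambda>X. sup_norm \<tau> (D X)) ` {X \<in> C0_compact_operators \<tau>. sup_norm \<tau> X \<le> 1})"
    by (intro bdd_aboveI2) blast
  then show ?thesis unfolding derivation_norm_def by (intro cSUP_upper) (use assms in auto)
qed

lemma derivation_norm_nonneg: "0 \<le> derivation_norm \<tau> D"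
proof -
  have zero: "(\<lambda>t. 0) \<in> C0_compact_operators \<tau>"
    using rank_one_C0_compact_operators[of "\<lambda>t. 0" \<tau> 0]
    by (auto simp: rank_one.zero_left C0_def intro: exI[of _ "{}"])
  \<comment> \<open>Any point of the type will do, since elements of the algebra are bounded by
    their sup norm also off the space.\<close>
  have "0 \<le> norm (D (\<lambda>t. 0) undefined)" by simp
  also have "\<dots> \<le> sup_norm \<tau> (D (\<lambda>t. 0))"
    by (rule C0_compact_operators_norm_le[OF D_closed[OF zero]])
  also have "\<dots> \<le> derivation_norm \<tau> D"
    by (rule derivation_norm_upper[OF zero]) (auto intro: sup_norm_least)
  finally show ?thesis .
qed

text \<open>The cut-off of x (x) e lies in the unit ball, and \<open>implement t x\<close> is the
  value at e of its derivative; hence the constant 1.\<close>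

lemma norm_multiplier: "norm (multiplier t) \<le> derivation_norm \<tau> D"
proof (rule norm_multiplier_le[OF _ derivation_norm_nonneg])
  fix t x assume t: "t \<in> topspace \<tau>" and x: "norm (x :: 'h) \<le> 1"
  let ?X = "bump_rank_one t x e"
  have "norm (?X s) \<le> 1" for s
  proof -
    have "norm (?X s) \<le> norm (bump t s *\<^sub>R x) * norm e"
      unfolding bump_rank_one_def by (rule norm_rank_one_le)
    also have "\<dots> \<le> 1"
      using bump_nonneg[of t s] bump_le_1[of t s] x norm_e by (simp add: mult_le_one)
    finally show ?thesis .
  qed
  then have "sup_norm \<tau> ?X \<le> 1" by (intro sup_norm_least) auto
  then have "norm (D ?X t) \<le> derivation_norm \<tau> D"
    using C0_compact_operators_norm_le[OF D_closed[OF bump_rank_one_C0]]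
      derivation_norm_upper[OF bump_rank_one_C0] order.trans by blast
  moreover have "norm (D ?X t e) \<le> norm (D ?X t) * norm e" by (rule norm_blinfun)
  moreover have "norm (D ?X t) * norm e \<le> norm (D ?X t)" using norm_e by (simp add: mult_left_le)
  ultimately show "norm (implement t x) \<le> derivation_norm \<tau> D" unfolding implement_def by linarith
qed

section \<open>Continuity of the multiplier and of its adjoint\<close>

lemma eventually_bump:
  assumes "t \<in> topspace \<tau>"
  shows "\<forall>\<^sub>F s in atin \<tau> t. s \<in> topspace \<tau> \<and> bump t s = 1"
proof -
  obtain U where "openin \<tau> U" "t \<in> U" "\<forall>s\<in>U. bump t s = 1" using bump_nhd[OF assms] by blast
  then show ?thesis by (auto simp: eventually_atin dest: openin_subset)
qed

lemma tendsto_D: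
  assumes "X \<in> C0_compact_operators \<tau>" "t \<in> topspace \<tau>"
  shows "(D X \<longlongrightarrow> D X t) (atin \<tau> t)"
  using D_closed[OF assms(1)] assms(2)
  by (simp add: C0_compact_operators_iff C0_def continuous_map_euclidean_atin)

lemma tendsto_multiplier:
  assumes t: "t \<in> topspace \<tau>"
  shows "((\<lambda>s. multiplier s x) \<longlongrightarrow> multiplier t x) (atin \<tau> t)"
proof (rule Lim_transform_eventually)
  show "((\<lambda>s. D (bump_rank_one t x e) s e) \<longlongrightarrow> multiplier t x) (atin \<tau> t)"
    using blinfun.tendsto[OF tendsto_D[OF bump_rank_one_C0 t, of t x e] tendsto_const[of e]]
    by (simp add: multiplier_apply t implement_def)
  show "\<forall>\<^sub>F s in atin \<tau> t. D (bump_rank_one t x e) s e = multiplier s x"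
    using eventually_bump[OF t]
  proof eventually_elim
    case (elim s)
    then show ?case using implement_eq_near[of s t x] by (simp add: multiplier_apply)
  qed
qed

text \<open>Continuity of the adjoints cannot be deduced from that of the multiplier and needs its
  own formula: \<open>cinner_implement\<close> read as an identity in its first vector.\<close>

lemma adjoint_multiplier_near:
  assumes s: "s \<in> topspace \<tau>" and "bump t s = 1"
  shows "hilbert_adjoint (multiplier s) y =
    cinner e (multiplier s e) *\<^sub>C y - hilbert_adjoint (D (bump_rank_one t e y) s) e"
proof (rule cinner_ext)
  fix z
  \<comment> \<open>\<open>cinner_implement\<close> at \<open>s\<close> involves the cut-off centred
    at \<open>s\<close>; locality exchanges it for the one at \<open>t\<close>, which does not
    change with \<open>s\<close>.\<close>
  have local: "D (bump_rank_one s e y) s = D (bump_rank_one t e y) s"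
    by (rule D_local[OF bump_rank_one_C0 bump_rank_one_C0]) (simp add: bump_rank_one_eq assms bump_self)
  have "cinner z (hilbert_adjoint (multiplier s) y) = cinner (implement s z) y"
    by (simp add: multiplier_apply s flip: cinner_hilbert_adjoint[OF multiplier_bounded_operators])
  also have "\<dots> = cinner z y * cinner (implement s e) e - cinner (D (bump_rank_one t e y) s z) e"
    by (simp only: cinner_implement[OF s, of z y] local)
  also have "\<dots> = cinner z (cinner e (multiplier s e) *\<^sub>C y - hilbert_adjoint (D (bump_rank_one t e y) s) e)"
    using cinner_commute[of "implement s e" e]
    by (simp add: cinner.diff_right cinner_scaleC_right multiplier_apply s mult.commute
        cinner_hilbert_adjoint[OF C0_compact_operators_bounded_operators[OF D_closed[OF bump_rank_one_C0]]])
  finally show "cinner z (hilbert_adjoint (multiplier s) y) =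
    cinner z (cinner e (multiplier s e) *\<^sub>C y - hilbert_adjoint (D (bump_rank_one t e y) s) e)" .
qed

lemma tendsto_adjoint_multiplier:
  assumes t: "t \<in> topspace \<tau>"
  shows "((\<lambda>s. hilbert_adjoint (multiplier s) y) \<longlongrightarrow> hilbert_adjoint (multiplier t) y) (atin \<tau> t)"
proof (rule Lim_transform_eventually)
  let ?X = "bump_rank_one t e y"
  have "D ?X s \<in> bounded_operators" for s
    by (rule C0_compact_operators_bounded_operators[OF D_closed[OF bump_rank_one_C0]])
  then have "((\<lambda>s. hilbert_adjoint (D ?X s)) \<longlongrightarrow> hilbert_adjoint (D ?X t)) (atin \<tau> t)"
    by (intro tendsto_hilbert_adjoint tendsto_D bump_rank_one_C0 t)
  then have "((\<lambda>s. cinner e (multiplier s e) *\<^sub>C y - hilbert_adjoint (D ?X s) e) \<longlongrightarrow>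
      cinner e (multiplier t e) *\<^sub>C y - hilbert_adjoint (D ?X t) e) (atin \<tau> t)"
    by (intro tendsto_diff scaleC.tendsto cinner.tendsto blinfun.tendsto tendsto_const tendsto_multiplier[OF t])
  then show "((\<lambda>s. cinner e (multiplier s e) *\<^sub>C y - hilbert_adjoint (D ?X s) e) \<longlongrightarrow>
      hilbert_adjoint (multiplier t) y) (atin \<tau> t)"
    by (simp add: adjoint_multiplier_near[OF t bump_self[OF t]])
  show "\<forall>\<^sub>F s in atin \<tau> t. cinner e (multiplier s e) *\<^sub>C y - hilbert_adjoint (D ?X s) e =
      hilbert_adjoint (multiplier s) y"
    using eventually_bump[OF t]
  proof eventually_elim
    case (elim s)
    then show ?case using adjoint_multiplier_near[of s t y] by simp
  qed
qed

lemma continuous_multiplier: "continuous_map \<tau> strong_star_topology multiplier"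
  by (rule continuous_map_strong_star_topology[OF multiplier_bounded_operators norm_multiplier])
    (simp_all add: continuous_map_euclidean_atin tendsto_multiplier tendsto_adjoint_multiplier)

end

theorem corollary3p10:
  fixes \<tau> :: "'l topology"
    and D :: "('l \<Rightarrow> ('h::complex_hilbert_space \<Rightarrow>\<^sub>L 'h)) \<Rightarrow> ('l \<Rightarrow> ('h \<Rightarrow>\<^sub>L 'h))"
  assumes "locally_compact_space \<tau>" and "Hausdorff_space \<tau>"
    and "derivation_C0 \<tau> D"
  shows "\<exists>Z\<^sub>0 :: 'l \<Rightarrow> ('h \<Rightarrow>\<^sub>L 'h).
    bounded (Z\<^sub>0 ` topspace \<tau>) \<and>
    continuous_map \<tau> strong_star_topology Z\<^sub>0 \<and>
    sup_norm \<tau> Z\<^sub>0 \<le> 2 * derivation_norm \<tau> D \<and>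
    (\<forall>X\<in>C0_compact_operators \<tau>. D X = pointwise_commutator Z\<^sub>0 X)"
proof -
  have "\<exists>e :: 'h. norm e \<le> 1 \<and> (\<forall>x :: 'h. cinner e e *\<^sub>C x = x)"
  proof (cases "\<forall>x :: 'h. x = 0")
    case True
    then show ?thesis by (intro exI[of _ 0]) (metis norm_zero zero_le_one)
  next
    case False
    then obtain y :: 'h where "y \<noteq> 0" by blast
    then have "norm (inverse (norm y) *\<^sub>R y) = 1" by simp
    then show ?thesis
      by (intro exI[of _ "inverse (norm y) *\<^sub>R y"]) (simp add: cinner_self scaleC_one)
  qed
  then obtain e :: 'h where e: "norm e \<le> 1" "\<And>x :: 'h. cinner e e *\<^sub>C x = x" by blast
  interpret C0_derivation_vector \<tau> D e
    by unfold_locales (use assms e in auto)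
  have "sup_norm \<tau> multiplier \<le> 2 * derivation_norm \<tau> D"
  proof (rule sup_norm_least)
    show "norm (multiplier t) \<le> 2 * derivation_norm \<tau> D" for t
      using norm_multiplier[of t] derivation_norm_nonneg by linarith
  qed (use derivation_norm_nonneg in simp)
  moreover have "bounded (multiplier ` topspace \<tau>)"
    using norm_multiplier by (auto simp: bounded_iff)
  ultimately show ?thesis
    using continuous_multiplier D_eq_commutator by blast
qed

end
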